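(* Let $\mathcal C$ be a category, let $\{[N_i,d_i]\}_{i\in I}$ be a center in $\mathcal C$, and put $\Sigma=\{d_i\}_{i\in I}$. The canonical functor $\Theta:\mathcal C\to\mathcal C\left[\{(d_i)^{-1}\circ N_i\}_{i\in I}\right]$ (which is an object of $Cat_{\mathcal C}^{\Sigma\text{-reg}}$) represents the covariant functor $Cat_{\mathcal C}^{\Sigma\text{-reg}}\to Set$ given by $$(\mathcal C\xrightarrow{F}\mathcal D)\longmapsto\begin{cases}\{*\},&\text{if } S^{\mathcal D}_{F(N_i)}\subset S^{\mathcal D}_{F(d_i)}\text{ for every } i\in I;\\ \varnothing,&\text{else.}\end{cases}$$
   Context: Sieves. A sieve in a category $\mathcal C$ is a collection of morphisms stable under precomposition; a sieve over an object $Y$ is a sieve all of whose morphisms have codomain $Y$. For a collection $E$ of morphisms of $\mathcal C$, $S^{\mathcal C}_E$ denotes the sieve generated by $E$, i.e. the collection of all $e\circ n$ with $e\in E$, $n\in Mor\,\mathcal C$, $cod(n)=dom(e)$; for a single morphism $d$, $S^{\mathcal C}_d:=S^{\mathcal C}_{\{d\}}$. Localization. For a collection $\Sigma$ of morphisms of $\mathcal C$, let $\mathcal G$ be the directed graph whose vertices are the objects of $\mathcal C$ and whose directed lines are: a line $a:dom(a)\to cod(a)$ for each morphism $a$ of $\mathcal C$, and a line $l_d:cod(d)\to dom(d)$ for each $d\in\Sigma$. A $\Sigma$-sequence is a finite, possibly empty, path of composable directed lines of $\mathcal G$ (an empty sequence is given by an object). Two $\Sigma$-sequences with the same domain and codomain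 are equivalent if they are related by a chain of replacements of consecutive parts (written in order of traversal): $X\xrightarrow{a}Y\xrightarrow{a'}Z \leftrightsquigarrow X\xrightarrow{a'\circ a}Z$ for $a,a'\in Mor\,\mathcal C$; $l_d,d\leftrightsquigarrow$ empty and $d,l_d\leftrightsquigarrow$ empty for $d\in\Sigma$; $Id_X\leftrightsquigarrow$ empty sequence at $X$. The class of $s$ is denoted $[s]$; a $\Sigma$-fraction is such a class. The localization $\mathcal C[\Sigma^{-1}]$ has the objects of $\mathcal C$ as objects and $\Sigma$-fractions as morphisms (composed by concatenation); the localization functor $\mathcal C\to\mathcal C[\Sigma^{-1}]$ is the identity on objects and $a\mapsto[a]$ on morphisms. Dilatation. A center in $\mathcal C$ is a collection $\{[N_i,d_i]\}_{i\in I}$ where each $d_i$ is a morphism of $\mathcal C$ and $N_i$ is a sieve over $cod(d_i)$. Put $\Sigma=\{d_i\}_{i\in I}$. A $\{[N_i,d_i]\}_{i\in I}$-fraction is a $\Sigma$-fraction having a representative of the form $X_1\xrightarrow{n_1}Y_1\xrightarrow{l_{d_{i_1}}}X_2\xrightarrow{n_2}Y_2\xrightarrow{l_{d_{i_2}}}X_3\cdots X_k\xrightarrow{n_k}Y_k\xrightarrow{l_{d_{i_k}}}X_{k+1}\xrightarrow{a}X_{k+2}$ with $a\in Mor\,\mathcal C$, $k\ge 0$, $i_j\in I$ and $n_j\in N_{i_j}$ for all $j$. The dilatation $\mathcal C\left[\{(d_i)^{-1}\circ N_i\}_{i\in I}\right]$ is the category with the same objects as $\mathcal C$ and with $\{[N_i,d_i]\}_{i\in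 I}$-fractions as morphisms (a subcategory of $\mathcal C[\Sigma^{-1}]$). The canonical functor $\Theta$ is the identity on objects and $\Theta(a)=[a]$ on morphisms. $Cat_{\mathcal C}^{\Sigma\text{-reg}}$ is the full subcategory of the comma category $\mathcal C/Cat$ (objects: functors out of $\mathcal C$; morphisms from $F_1:\mathcal C\to\mathcal D_1$ to $F_2:\mathcal C\to\mathcal D_2$: functors $G:\mathcal D_1\to\mathcal D_2$ with $G\circ F_1=F_2$) whose objects $F:\mathcal C\to\mathcal D$ are the functors such that the localization functor $\mathcal D\to\mathcal D[F(\Sigma)^{-1}]$ is faithful. "$\Theta$ represents the functor $h$" means that $Hom(\Theta,F)\cong h(F)$ naturally in $F$, where $Hom$ is taken in $Cat_{\mathcal C}^{\Sigma\text{-reg}}$. *)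

theory Defs
  imports Main "HOL-Library.FuncSet"
begin

section \<open>Categories and functors\<close>

text \<open>\<open>Comp C g f\<close> is the composite of \<open>f\<close> followed by \<open>g\<close>; it is only meaningful
  when \<open>Cod C f = Dom C g\<close>.\<close>

record ('o, 'm) cat =
  Obj :: "'o set"
  Arr :: "'m set"
  Dom :: "'m \<Rightarrow> 'o"
  Cod :: "'m \<Rightarrow> 'o"
  Ide :: "'o \<Rightarrow> 'm"
  Comp :: "'m \<Rightarrow> 'm \<Rightarrow> 'm"

locale category =
  fixes C :: "('o, 'm) cat"
  assumes Dom_in: "f \<in> Arr C \<Longrightarrow> Dom C f \<in> Obj C"
    and Cod_in: "f \<in> Arr C \<Longrightarrow> Cod C f \<in> Obj C"
    and Ide_in: "X \<in> Obj C \<Longrightarrow> Ide C X \<in> Arr C"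
    and Dom_Ide: "X \<in> Obj C \<Longrightarrow> Dom C (Ide C X) = X"
    and Cod_Ide: "X \<in> Obj C \<Longrightarrow> Cod C (Ide C X) = X"
    and Comp_in: "\<lbrakk>f \<in> Arr C; g \<in> Arr C; Cod C f = Dom C g\<rbrakk> \<Longrightarrow> Comp C g f \<in> Arr C"
    and Dom_Comp: "\<lbrakk>f \<in> Arr C; g \<in> Arr C; Cod C f = Dom C g\<rbrakk> \<Longrightarrow> Dom C (Comp C g f) = Dom C f"
    and Cod_Comp: "\<lbrakk>f \<in> Arr C; g \<in> Arr C; Cod C f = Dom C g\<rbrakk> \<Longrightarrow> Cod C (Comp C g f) = Cod C g"
    and Comp_Ide_right: "f \<in> Arr C \<Longrightarrow> Comp C f (Ide C (Dom C f)) = f"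
    and Comp_Ide_left: "f \<in> Arr C \<Longrightarrow> Comp C (Ide C (Cod C f)) f = f"
    and Comp_assoc: "\<lbrakk>f \<in> Arr C; g \<in> Arr C; h \<in> Arr C; Cod C f = Dom C g; Cod C g = Dom C h\<rbrakk>
      \<Longrightarrow> Comp C h (Comp C g f) = Comp C (Comp C h g) f"

text \<open>A functor is a pair (object map, arrow map). Both maps are required to be
  \<open>undefined\<close> off the carriers, so that equality of pairs is equality of functors.\<close>

type_synonym ('o, 'm, 'p, 'q) functr = "('o \<Rightarrow> 'p) \<times> ('m \<Rightarrow> 'q)"

abbreviation ob_map :: "('o, 'm, 'p, 'q) functr \<Rightarrow> 'o \<Rightarrow> 'p"
  where "ob_map \<equiv> fst"

abbreviation arr_map :: "('o, 'm, 'p, 'q) functr \<Rightarrow> 'm \<Rightarrow> 'q"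
  where "arr_map \<equiv> snd"

definition is_functor ::
  "('o, 'm) cat \<Rightarrow> ('p, 'q) cat \<Rightarrow> ('o, 'm, 'p, 'q) functr \<Rightarrow> bool" where
  "is_functor C D F \<longleftrightarrow>
     ob_map F \<in> Obj C \<rightarrow>\<^sub>E Obj D \<and>
     arr_map F \<in> Arr C \<rightarrow>\<^sub>E Arr D \<and>
     (\<forall>f\<in>Arr C. Dom D (arr_map F f) = ob_map F (Dom C f)) \<and>
     (\<forall>f\<in>Arr C. Cod D (arr_map F f) = ob_map F (Cod C f)) \<and>
     (\<forall>X\<in>Obj C. arr_map F (Ide C X) = Ide D (ob_map F X)) \<and>
     (\<forall>f\<in>Arr C. \<forall>g\<in>Arr C. Cod C f = Dom C g \<longrightarrow>
        arr_map F (Comp C g f) = Comp D (arr_map F g) (arr_map F f))"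

definition id_functor :: "('o, 'm) cat \<Rightarrow> ('o, 'm, 'o, 'm) functr" where
  "id_functor C = ((\<lambda>X\<in>Obj C. X), (\<lambda>f\<in>Arr C. f))"

text \<open>In \<open>comp_functor C G F\<close> the category \<open>C\<close> is the source of \<open>F\<close>.\<close>

definition comp_functor ::
  "('o, 'm) cat \<Rightarrow> ('p, 'q, 'r, 's) functr \<Rightarrow> ('o, 'm, 'p, 'q) functr \<Rightarrow> ('o, 'm, 'r, 's) functr"
  where
  "comp_functor C G F =
     (compose (Obj C) (ob_map G) (ob_map F), compose (Arr C) (arr_map G) (arr_map F))"

definition faithful_functor :: "('o, 'm) cat \<Rightarrow> ('o, 'm, 'p, 'q) functr \<Rightarrow> bool" where
  "faithful_functor C F \<longleftrightarrow>
     (\<forall>f\<in>Arr C. \<forall>g\<in>Arr C. Dom C f = Dom C g \<longrightarrow> Cod C f = Cod C g \<longrightarrow>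
        arr_map F f = arr_map F g \<longrightarrow> f = g)"


section \<open>Sieves and centers\<close>

definition sieve :: "('o, 'm) cat \<Rightarrow> 'm set \<Rightarrow> bool" where
  "sieve C S \<longleftrightarrow>
     S \<subseteq> Arr C \<and> (\<forall>s\<in>S. \<forall>n\<in>Arr C. Cod C n = Dom C s \<longrightarrow> Comp C s n \<in> S)"

definition sieve_over :: "('o, 'm) cat \<Rightarrow> 'o \<Rightarrow> 'm set \<Rightarrow> bool" where
  "sieve_over C Y S \<longleftrightarrow> sieve C S \<and> (\<forall>s\<in>S. Cod C s = Y)"

definition gen_sieve :: "('o, 'm) cat \<Rightarrow> 'm set \<Rightarrow> 'm set" where
  "gen_sieve C E = {Comp C e n | e n. e \<in> E \<and> n \<in> Arr C \<and> Cod C n = Dom C e}"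

definition center :: "('o, 'm) cat \<Rightarrow> 'i set \<Rightarrow> ('i \<Rightarrow> 'm set) \<Rightarrow> ('i \<Rightarrow> 'm) \<Rightarrow> bool" where
  "center C I N d \<longleftrightarrow> (\<forall>i\<in>I. d i \<in> Arr C \<and> sieve_over C (Cod C (d i)) (N i))"


section \<open>Localization\<close>

text \<open>\<open>Fwd a\<close> is the line of the morphism \<open>a\<close>, and \<open>Bwd d\<close> is the formal inverse line
  \<open>l\<^sub>d\<close> from \<open>Cod C d\<close> to \<open>Dom C d\<close>.\<close>

datatype 'm line = Fwd 'm | Bwd 'm

definition lines :: "('o, 'm) cat \<Rightarrow> 'm set \<Rightarrow> 'm line set" where
  "lines C \<Sigma> = Fwd ` Arr C \<union> Bwd ` \<Sigma>"

fun line_dom :: "('o, 'm) cat \<Rightarrow> 'm line \<Rightarrow> 'o" where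
  "line_dom C (Fwd a) = Dom C a"
| "line_dom C (Bwd d) = Cod C d"

fun line_cod :: "('o, 'm) cat \<Rightarrow> 'm line \<Rightarrow> 'o" where
  "line_cod C (Fwd a) = Cod C a"
| "line_cod C (Bwd d) = Dom C d"

fun is_path :: "('o, 'm) cat \<Rightarrow> 'm set \<Rightarrow> 'o \<Rightarrow> 'm line list \<Rightarrow> 'o \<Rightarrow> bool" where
  "is_path C \<Sigma> X [] Y \<longleftrightarrow> X \<in> Obj C \<and> X = Y"
| "is_path C \<Sigma> X (l # ls) Y \<longleftrightarrow>
     l \<in> lines C \<Sigma> \<and> line_dom C l = X \<and> is_path C \<Sigma> (line_cod C l) ls Y"

text \<open>A \<open>\<Sigma>\<close>-sequence is recorded as (domain, lines in order of traversal, codomain); in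
  particular \<open>(X, [], X)\<close> is the empty sequence at \<open>X\<close>.\<close>

type_synonym ('o, 'm) seq = "'o \<times> 'm line list \<times> 'o"

definition seqs :: "('o, 'm) cat \<Rightarrow> 'm set \<Rightarrow> ('o, 'm) seq set" where
  "seqs C \<Sigma> = {(X, ls, Y). is_path C \<Sigma> X ls Y}"

inductive move :: "('o, 'm) cat \<Rightarrow> 'm set \<Rightarrow> 'm line list \<Rightarrow> 'm line list \<Rightarrow> bool"
  for C :: "('o, 'm) cat" and \<Sigma> :: "'m set" where
  move_comp: "\<lbrakk>a \<in> Arr C; a' \<in> Arr C; Cod C a = Dom C a'\<rbrakk>
    \<Longrightarrow> move C \<Sigma> [Fwd a, Fwd a'] [Fwd (Comp C a' a)]"
| move_Bwd_Fwd: "d \<in> \<Sigma> \<Longrightarrow> move C \<Sigma> [Bwd d, Fwd d] []"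
| move_Fwd_Bwd: "d \<in> \<Sigma> \<Longrightarrow> move C \<Sigma> [Fwd d, Bwd d] []"
| move_Ide: "X \<in> Obj C \<Longrightarrow> move C \<Sigma> [Fwd (Ide C X)] []"

definition seq_step :: "('o, 'm) cat \<Rightarrow> 'm set \<Rightarrow> (('o, 'm) seq \<times> ('o, 'm) seq) set" where
  "seq_step C \<Sigma> =
     {((X, us @ p @ vs, Y), (X, us @ q @ vs, Y)) | X Y us vs p q.
        move C \<Sigma> p q \<and>
        (X, us @ p @ vs, Y) \<in> seqs C \<Sigma> \<and> (X, us @ q @ vs, Y) \<in> seqs C \<Sigma>}"

definition seq_equiv :: "('o, 'm) cat \<Rightarrow> 'm set \<Rightarrow> (('o, 'm) seq \<times> ('o, 'm) seq) set" where
  "seq_equiv C \<Sigma> = (seq_step C \<Sigma> \<union> (seq_step C \<Sigma>)\<inverse>)\<^sup>* \<inter> (seqs C \<Sigma> \<times> seqs C \<Sigma>)"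

type_synonym ('o, 'm) frac = "('o, 'm) seq set"

definition frac_of :: "('o, 'm) cat \<Rightarrow> 'm set \<Rightarrow> ('o, 'm) seq \<Rightarrow> ('o, 'm) frac" where
  "frac_of C \<Sigma> s = seq_equiv C \<Sigma> `` {s}"

fun seq_append :: "('o, 'm) seq \<Rightarrow> ('o, 'm) seq \<Rightarrow> ('o, 'm) seq" where
  "seq_append (X, us, Y) (Y', vs, Z) = (X, us @ vs, Z)"

text \<open>All members of a fraction have the same domain and codomain, and the classes in the
  union defining \<open>Comp\<close> are all equal.\<close>

definition localization :: "('o, 'm) cat \<Rightarrow> 'm set \<Rightarrow> ('o, ('o, 'm) frac) cat" where
  "localization C \<Sigma> =
     \<lparr>Obj = Obj C,
      Arr = seqs C \<Sigma> // seq_equiv C \<Sigma>,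
      Dom = (\<lambda>f. THE X. \<exists>s\<in>f. fst s = X),
      Cod = (\<lambda>f. THE Y. \<exists>s\<in>f. snd (snd s) = Y),
      Ide = (\<lambda>X. frac_of C \<Sigma> (X, [], X)),
      Comp = (\<lambda>g f. \<Union>s\<in>f. \<Union>t\<in>g. frac_of C \<Sigma> (seq_append s t))\<rparr>"

definition localization_functor ::
  "('o, 'm) cat \<Rightarrow> 'm set \<Rightarrow> ('o, 'm, 'o, ('o, 'm) frac) functr" where
  "localization_functor C \<Sigma> =
     ((\<lambda>X\<in>Obj C. X), (\<lambda>a\<in>Arr C. frac_of C \<Sigma> (Dom C a, [Fwd a], Cod C a)))"


section \<open>Dilatation\<close>

text \<open>The list \<open>ps\<close> holds the pairs \<open>(i\<^sub>1, n\<^sub>1), \<dots>, (i\<^sub>k, n\<^sub>k)\<close> of a representative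
  \<open>n\<^sub>1, l\<^bsub>d i\<^sub>1\<^esub>, \<dots>, n\<^sub>k, l\<^bsub>d i\<^sub>k\<^esub>, a\<close>; membership in \<open>seqs\<close> imposes composability.\<close>

definition standard_seqs ::
  "('o, 'm) cat \<Rightarrow> 'i set \<Rightarrow> ('i \<Rightarrow> 'm set) \<Rightarrow> ('i \<Rightarrow> 'm) \<Rightarrow> ('o, 'm) seq set" where
  "standard_seqs C I N d =
     {(X, concat (map (\<lambda>(i, n). [Fwd n, Bwd (d i)]) ps) @ [Fwd a], Y) | X Y ps a.
        (\<forall>(i, n)\<in>set ps. i \<in> I \<and> n \<in> N i) \<and> a \<in> Arr C} \<inter> seqs C (d ` I)"

definition dilatation ::
  "('o, 'm) cat \<Rightarrow> 'i set \<Rightarrow> ('i \<Rightarrow> 'm set) \<Rightarrow> ('i \<Rightarrow> 'm) \<Rightarrow> ('o, ('o, 'm) frac) cat" where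
  "dilatation C I N d =
     (localization C (d ` I))\<lparr>Arr := frac_of C (d ` I) ` standard_seqs C I N d\<rparr>"

definition dilatation_functor ::
  "('o, 'm) cat \<Rightarrow> 'i set \<Rightarrow> ('i \<Rightarrow> 'm) \<Rightarrow> ('o, 'm, 'o, ('o, 'm) frac) functr" where
  "dilatation_functor C I d =
     ((\<lambda>X\<in>Obj C. X), (\<lambda>a\<in>Arr C. frac_of C (d ` I) (Dom C a, [Fwd a], Cod C a)))"


section \<open>The category of regular functors under \<open>C\<close>\<close>

text \<open>An object \<open>(D, F)\<close> is a functor \<open>F\<close> from \<open>C\<close> to \<open>D\<close>. The types \<open>'p\<close> and \<open>'q\<close> of
  objects and arrows of \<open>D\<close> play the role of the universe in which \<open>Cat\<close> is formed. Hom
  sets are defined across universes, because the dilatation of \<open>C\<close> lives in the universe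
  determined by the types of \<open>C\<close>, while targets are to range over arbitrary universes.\<close>

type_synonym ('o, 'm, 'p, 'q) under = "('p, 'q) cat \<times> ('o, 'm, 'p, 'q) functr"

definition reg_objs :: "('o, 'm) cat \<Rightarrow> 'm set \<Rightarrow> ('o, 'm, 'p, 'q) under set" where
  "reg_objs C \<Sigma> =
     {(D, F). category D \<and> is_functor C D F \<and>
        faithful_functor D (localization_functor D (arr_map F ` \<Sigma>))}"

definition under_hom ::
  "('o, 'm) cat \<Rightarrow> ('o, 'm, 'p, 'q) under \<Rightarrow> ('o, 'm, 'r, 's) under \<Rightarrow>
     ('p, 'q, 'r, 's) functr set" where
  "under_hom C A B =
     {G. is_functor (fst A) (fst B) G \<and> comp_functor C G (snd A) = snd B}"

text \<open>Covariant functors from the category of regular functors (in the universe \<open>'p\<close>, \<open>'q\<close>)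
  to sets, given by an object part \<open>hO\<close> and an arrow part \<open>hM\<close>.\<close>

definition reg_set_functor ::
  "('o, 'm) cat \<Rightarrow> 'm set \<Rightarrow> (('o, 'm, 'p, 'q) under \<Rightarrow> 'x set) \<Rightarrow>
     (('o, 'm, 'p, 'q) under \<Rightarrow> ('o, 'm, 'p, 'q) under \<Rightarrow> ('p, 'q, 'p, 'q) functr \<Rightarrow> 'x \<Rightarrow> 'x) \<Rightarrow>
     bool" where
  "reg_set_functor C \<Sigma> hO hM \<longleftrightarrow>
     (\<forall>A\<in>reg_objs C \<Sigma>. \<forall>B\<in>reg_objs C \<Sigma>. \<forall>G\<in>under_hom C A B. hM A B G \<in> hO A \<rightarrow>\<^sub>E hO B) \<and>
     (\<forall>A\<in>reg_objs C \<Sigma>. hM A A (id_functor (fst A)) = (\<lambda>x\<in>hO A. x)) \<and>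
     (\<forall>A\<in>reg_objs C \<Sigma>. \<forall>B\<in>reg_objs C \<Sigma>. \<forall>E\<in>reg_objs C \<Sigma>.
        \<forall>G\<in>under_hom C A B. \<forall>H\<in>under_hom C B E.
          hM A E (comp_functor (fst A) H G) = compose (hO A) (hM B E H) (hM A B G))"

definition represents ::
  "('o, 'm) cat \<Rightarrow> 'm set \<Rightarrow> ('o, 'm, 'r, 's) under \<Rightarrow>
     (('o, 'm, 'p, 'q) under \<Rightarrow> 'x set) \<Rightarrow>
     (('o, 'm, 'p, 'q) under \<Rightarrow> ('o, 'm, 'p, 'q) under \<Rightarrow> ('p, 'q, 'p, 'q) functr \<Rightarrow> 'x \<Rightarrow> 'x) \<Rightarrow>
     bool" where
  "represents C \<Sigma> T hO hM \<longleftrightarrow>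
     T \<in> reg_objs C \<Sigma> \<and>
     (\<exists>\<eta>. (\<forall>A\<in>reg_objs C \<Sigma>. bij_betw (\<eta> A) (under_hom C T A) (hO A)) \<and>
          (\<forall>A\<in>reg_objs C \<Sigma>. \<forall>B\<in>reg_objs C \<Sigma>. \<forall>G\<in>under_hom C A B. \<forall>K\<in>under_hom C T A.
             \<eta> B (comp_functor (fst T) G K) = hM A B G (\<eta> A K)))"

text \<open>The one-point set is \<open>{()}\<close>; the arrow part is the only possible one.\<close>

definition dil_ob ::
  "'i set \<Rightarrow> ('i \<Rightarrow> 'm set) \<Rightarrow> ('i \<Rightarrow> 'm) \<Rightarrow> ('o, 'm, 'p, 'q) under \<Rightarrow> unit set" where
  "dil_ob I N d = (\<lambda>(D, F).
     if \<forall>i\<in>I. gen_sieve D (arr_map F ` N i) \<subseteq> gen_sieve D {arr_map F (d i)}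
     then {()} else {})"

definition dil_arr ::
  "'i set \<Rightarrow> ('i \<Rightarrow> 'm set) \<Rightarrow> ('i \<Rightarrow> 'm) \<Rightarrow>
     ('o, 'm, 'p, 'q) under \<Rightarrow> ('o, 'm, 'p, 'q) under \<Rightarrow> ('p, 'q, 'p, 'q) functr \<Rightarrow>
     unit \<Rightarrow> unit" where
  "dil_arr I N d A B G = (\<lambda>x\<in>dil_ob I N d A. ())"

end

theory Submission
  imports Defs
begin

text \<open>The dilatation is generated by the morphisms \<open>\<Theta>(a)\<close> and \<open>l\<^bsub>d i\<^esub> \<circ> n\<close> with \<open>n \<in> N i\<close>. If
  \<open>D\<close> embeds faithfully into \<open>D[F(\<Sigma>)\<^sup>-\<^sup>1]\<close>, then each \<open>F(d i)\<close> is monic, so a functor \<open>K\<close> with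
  \<open>K \<circ> \<Theta> = F\<close> must send \<open>l\<^bsub>d i\<^esub> \<circ> n\<close> to the unique \<open>x\<close> with \<open>F(n) = F(d i) \<circ> x\<close>. Such \<open>x\<close> exist
  exactly when the sieve condition holds, and then the functor from \<open>C[\<Sigma>\<^sup>-\<^sup>1]\<close> to \<open>D[F(\<Sigma>)\<^sup>-\<^sup>1]\<close>
  induced by \<open>F\<close> maps the dilatation into \<open>D\<close>, which gives \<open>K\<close>.\<close>

section \<open>Functors\<close>

lemma functor_ob: "is_functor C D F \<Longrightarrow> X \<in> Obj C \<Longrightarrow> ob_map F X \<in> Obj D"
  and functor_arr: "is_functor C D F \<Longrightarrow> f \<in> Arr C \<Longrightarrow> arr_map F f \<in> Arr D"
  and functor_Dom: "is_functor C D F \<Longrightarrow> f \<in> Arr C \<Longrightarrow> Dom D (arr_map F f) = ob_map F (Dom C f)"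
  and functor_Cod: "is_functor C D F \<Longrightarrow> f \<in> Arr C \<Longrightarrow> Cod D (arr_map F f) = ob_map F (Cod C f)"
  and functor_Ide: "is_functor C D F \<Longrightarrow> X \<in> Obj C \<Longrightarrow> arr_map F (Ide C X) = Ide D (ob_map F X)"
  and functor_Comp: "is_functor C D F \<Longrightarrow> f \<in> Arr C \<Longrightarrow> g \<in> Arr C \<Longrightarrow> Cod C f = Dom C g \<Longrightarrow>
    arr_map F (Comp C g f) = Comp D (arr_map F g) (arr_map F f)"
  by (auto simp: is_functor_def)

lemmas functor_simps = functor_ob functor_arr functor_Dom functor_Cod functor_Ide functor_Comp

lemma functor_eqI:
  assumes "is_functor C D F" "is_functor C D G"
    and "\<And>X. X \<in> Obj C \<Longrightarrow> ob_map F X = ob_map G X"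
    and "\<And>f. f \<in> Arr C \<Longrightarrow> arr_map F f = arr_map G f"
  shows "F = G"
proof (rule prod_eqI)
  show "ob_map F = ob_map G"
    using assms(1-3) unfolding is_functor_def by (intro PiE_ext[of _ "Obj C" "\<lambda>_. Obj D"]) auto
  show "arr_map F = arr_map G"
    using assms(1,2,4) unfolding is_functor_def by (intro PiE_ext[of _ "Arr C" "\<lambda>_. Arr D"]) auto
qed

lemma comp_functor_ob: "X \<in> Obj C \<Longrightarrow> ob_map (comp_functor C G F) X = ob_map G (ob_map F X)"
  and comp_functor_arr: "f \<in> Arr C \<Longrightarrow> arr_map (comp_functor C G F) f = arr_map G (arr_map F f)"
  by (auto simp: comp_functor_def compose_def)

lemma is_functor_comp:
  assumes "category C" and F: "is_functor C D F" and G: "is_functor D E G"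
  shows "is_functor C E (comp_functor C G F)"
proof -
  interpret category C by fact
  have "ob_map (comp_functor C G F) \<in> Obj C \<rightarrow>\<^sub>E Obj E"
    and "arr_map (comp_functor C G F) \<in> Arr C \<rightarrow>\<^sub>E Arr E"
    by (auto simp: comp_functor_def compose_def functor_simps[OF F] functor_simps[OF G])
  then show ?thesis
    unfolding is_functor_def
    by (simp add: comp_functor_ob comp_functor_arr Dom_in Cod_in Ide_in Comp_in
        functor_simps[OF F] functor_simps[OF G])
qed

section \<open>Inverse pairs of arrows and values of words of lines\<close>

definition inverse_arrows :: "('o, 'm) cat \<Rightarrow> 'm \<Rightarrow> 'm \<Rightarrow> bool" where
  "inverse_arrows C f g \<longleftrightarrow>
     f \<in> Arr C \<and> g \<in> Arr C \<and> Dom C g = Cod C f \<and> Cod C g = Dom C f \<and>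
     Comp C g f = Ide C (Dom C f) \<and> Comp C f g = Ide C (Cod C f)"

lemma inverse_arrows_cancel:
  assumes "category C" "inverse_arrows C f g" "x \<in> Arr C" "y \<in> Arr C"
    and "Cod C x = Dom C f" "Cod C y = Dom C f" "Comp C f x = Comp C f y"
  shows "x = y"
proof -
  interpret category C by fact
  have "Comp C g (Comp C f z) = z" if "z \<in> Arr C" "Cod C z = Dom C f" for z
    using Comp_assoc[of z f g] Comp_Ide_left[of z] that assms(2)
    unfolding inverse_arrows_def by metis
  then show ?thesis using assms(3-7) by metis
qed

primrec line_val :: "('o, 'm, 'p, 'q) functr \<Rightarrow> ('m \<Rightarrow> 'q) \<Rightarrow> 'm line \<Rightarrow> 'q" where
  "line_val G r (Fwd a) = arr_map G a"
| "line_val G r (Bwd s) = r s"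

text \<open>Lines are composed in order of traversal, ending in the identity at the codomain
  \<open>Y\<close>; a one-line word thus evaluates to its line followed by an identity.\<close>

primrec path_val :: "('p, 'q) cat \<Rightarrow> ('l \<Rightarrow> 'q) \<Rightarrow> 'p \<Rightarrow> 'l list \<Rightarrow> 'q" where
  "path_val E v Y [] = Ide E Y"
| "path_val E v Y (l # ls) = Comp E (path_val E v Y ls) (v l)"

section \<open>The localization\<close>

locale localizing = category C for C :: "('o, 'm) cat" +
  fixes \<Sigma> :: "'m set"
  assumes \<Sigma>_arr: "\<Sigma> \<subseteq> Arr C"
begin

abbreviation "frac \<equiv> frac_of C \<Sigma>"
abbreviation "Loc \<equiv> localization C \<Sigma>"
abbreviation "L \<equiv> localization_functor C \<Sigma>"

section \<open>Paths, elementary moves and the classes they generate\<close>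

lemma line_ends: "l \<in> lines C \<Sigma> \<Longrightarrow> line_dom C l \<in> Obj C \<and> line_cod C l \<in> Obj C"
  using \<Sigma>_arr by (auto simp: lines_def Dom_in Cod_in)

lemma path_ends: "is_path C \<Sigma> X ls Y \<Longrightarrow> X \<in> Obj C \<and> Y \<in> Obj C"
  by (induction ls arbitrary: X) (auto simp: line_ends)

lemma path_append:
  "is_path C \<Sigma> X (us @ vs) Z \<longleftrightarrow> (\<exists>Y. is_path C \<Sigma> X us Y \<and> is_path C \<Sigma> Y vs Z)"
  by (induction us arbitrary: X) (auto dest: path_ends)

lemma path_appendI:
  "is_path C \<Sigma> X us Y \<Longrightarrow> is_path C \<Sigma> Y vs Z \<Longrightarrow> is_path C \<Sigma> X (us @ vs) Z"
  by (auto simp: path_append)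

lemma Fwd_line [simp]: "Fwd a \<in> lines C \<Sigma> \<longleftrightarrow> a \<in> Arr C"
  and Bwd_line [simp]: "Bwd a \<in> lines C \<Sigma> \<longleftrightarrow> a \<in> \<Sigma>"
  by (auto simp: lines_def)

lemma path_Fwd: "a \<in> Arr C \<Longrightarrow> is_path C \<Sigma> (Dom C a) [Fwd a] (Cod C a)"
  by (simp add: Cod_in)

text \<open>Both sides of each move have the same ends. The converse fails in general: an empty path
  exists at every object, whereas \<open>[Bwd d, Fwd d]\<close> starts only at
  \<open>Cod C d\<close>.\<close>

lemma move_path: "move C \<Sigma> p q \<Longrightarrow> is_path C \<Sigma> X p Y \<Longrightarrow> is_path C \<Sigma> X q Y"
  by (induction rule: move.induct)
    (use \<Sigma>_arr in \<open>auto simp: Dom_Comp Cod_Comp Comp_in Dom_Ide Cod_Ide\<close>)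

lemma seqs_iff [simp]: "(X, ls, Y) \<in> seqs C \<Sigma> \<longleftrightarrow> is_path C \<Sigma> X ls Y"
  by (simp add: seqs_def)

lemma move_step:
  assumes "move C \<Sigma> p q" "is_path C \<Sigma> X us A" "is_path C \<Sigma> A p B" "is_path C \<Sigma> B vs Y"
  shows "((X, us @ p @ vs, Y), (X, us @ q @ vs, Y)) \<in> seq_step C \<Sigma>"
proof -
  have "is_path C \<Sigma> X (us @ p @ vs) Y" "is_path C \<Sigma> X (us @ q @ vs) Y"
    using assms move_path[OF assms(1,3)] by (auto simp: path_append)
  then show ?thesis
    using assms(1) unfolding seq_step_def by fastforce
qed

lemma seq_stepE:
  assumes "(s, t) \<in> seq_step C \<Sigma>"
  obtains X us A p q B vs Y where "s = (X, us @ p @ vs, Y)" "t = (X, us @ q @ vs, Y)"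
    "move C \<Sigma> p q" "is_path C \<Sigma> X us A" "is_path C \<Sigma> A p B" "is_path C \<Sigma> B vs Y"
  using assms unfolding seq_step_def by (auto simp: path_append)

lemma step_in_seqs: "(s, t) \<in> seq_step C \<Sigma> \<Longrightarrow> s \<in> seqs C \<Sigma> \<and> t \<in> seqs C \<Sigma>"
  unfolding seq_step_def by auto

text \<open>Spares later inductions the closure over steps and reversed steps: a relation that is an
  equivalence has to be checked on single steps only.\<close>

lemma seq_equiv_induct [consumes 1, case_names refl sym trans step]:
  assumes "(s, t) \<in> seq_equiv C \<Sigma>"
    and refl: "\<And>s. s \<in> seqs C \<Sigma> \<Longrightarrow> P s s"
    and sym: "\<And>s t. P s t \<Longrightarrow> P t s"
    and trans: "\<And>s t u. P s t \<Longrightarrow> P t u \<Longrightarrow> P s u"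
    and step: "\<And>s t. (s, t) \<in> seq_step C \<Sigma> \<Longrightarrow> P s t"
  shows "P s t"
proof -
  have "(s, t) \<in> (seq_step C \<Sigma> \<union> (seq_step C \<Sigma>)\<inverse>)\<^sup>*" "s \<in> seqs C \<Sigma>"
    using assms(1) by (auto simp: seq_equiv_def)
  then show ?thesis
    by (induction rule: rtrancl_induct) (use refl sym trans step in blast)+
qed

lemma step_equiv: "(s, t) \<in> seq_step C \<Sigma> \<Longrightarrow> (s, t) \<in> seq_equiv C \<Sigma>"
  using step_in_seqs unfolding seq_equiv_def by auto

lemma equiv_seqs: "equiv (seqs C \<Sigma>) (seq_equiv C \<Sigma>)"
proof (rule equivI)
  have "sym ((seq_step C \<Sigma> \<union> (seq_step C \<Sigma>)\<inverse>)\<^sup>*)"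
    by (rule sym_rtrancl) (auto simp: sym_def)
  then show "sym (seq_equiv C \<Sigma>)"
    unfolding seq_equiv_def by (auto simp: sym_def)
  show "trans (seq_equiv C \<Sigma>)"
    unfolding seq_equiv_def by (auto simp: trans_def)
qed (auto simp: seq_equiv_def refl_on_def)

lemma frac_eq_iff: "s \<in> seqs C \<Sigma> \<Longrightarrow> t \<in> seqs C \<Sigma> \<Longrightarrow> frac s = frac t \<longleftrightarrow> (s, t) \<in> seq_equiv C \<Sigma>"
  unfolding frac_of_def by (metis eq_equiv_class equiv_class_eq equiv_seqs)

lemma in_frac: "s \<in> seqs C \<Sigma> \<Longrightarrow> t \<in> frac s \<longleftrightarrow> t \<in> seqs C \<Sigma> \<and> frac s = frac t"
  using frac_eq_iff[of s t] by (auto simp: frac_of_def seq_equiv_def)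

text \<open>A step performed inside a larger sequence is again a step. Equality of the ends is
  proved along with it, since for symmetry and transitivity the paths attached to \<open>s\<close>
  must also fit \<open>t\<close>.\<close>

lemma equiv_context:
  assumes "(s, t) \<in> seq_equiv C \<Sigma>"
  shows "fst s = fst t \<and> snd (snd s) = snd (snd t) \<and>
    (\<forall>W us vs Z. is_path C \<Sigma> W us (fst s) \<longrightarrow> is_path C \<Sigma> (snd (snd s)) vs Z \<longrightarrow>
      frac (W, us @ fst (snd s) @ vs, Z) = frac (W, us @ fst (snd t) @ vs, Z))"
  using assms
proof (induction rule: seq_equiv_induct)
  case (step s t)
  then obtain X us A p q B vs Y where s: "s = (X, us @ p @ vs, Y)" "t = (X, us @ q @ vs, Y)"
    and p: "move C \<Sigma> p q" "is_path C \<Sigma> X us A" "is_path C \<Sigma> A p B" "is_path C \<Sigma> B vs Y"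
    by (rule seq_stepE)
  have "frac (W, us' @ (us @ p @ vs) @ vs', Z) = frac (W, us' @ (us @ q @ vs) @ vs', Z)"
    if "is_path C \<Sigma> W us' X" "is_path C \<Sigma> Y vs' Z" for W us' vs' Z
  proof -
    have "((W, (us' @ us) @ p @ (vs @ vs'), Z), (W, (us' @ us) @ q @ (vs @ vs'), Z)) \<in> seq_step C \<Sigma>"
      using that p by (intro move_step[of p q _ _ A B]) (auto simp: path_append)
    from step_equiv[OF this] step_in_seqs[OF this] show ?thesis
      by (simp add: frac_eq_iff)
  qed
  then show ?case by (auto simp: s)
qed auto

lemma frac_context:
  assumes "is_path C \<Sigma> X ls Y" "is_path C \<Sigma> X ls' Y" "frac (X, ls, Y) = frac (X, ls', Y)"
    and "is_path C \<Sigma> W us X" "is_path C \<Sigma> Y vs Z"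
  shows "frac (W, us @ ls @ vs, Z) = frac (W, us @ ls' @ vs, Z)"
proof -
  have "((X, ls, Y), (X, ls', Y)) \<in> seq_equiv C \<Sigma>"
    using assms frac_eq_iff by simp
  from equiv_context[OF this] assms(4,5) show ?thesis
    unfolding fst_conv snd_conv by blast
qed

lemma frac_eq_ends:
  assumes "is_path C \<Sigma> X ls Y" "is_path C \<Sigma> X' ls' Y'" "frac (X, ls, Y) = frac (X', ls', Y')"
  shows "X = X' \<and> Y = Y'"
  using assms equiv_context[of "(X, ls, Y)" "(X', ls', Y')"] by (simp add: frac_eq_iff)

lemma frac_move:
  assumes "move C \<Sigma> p q" "is_path C \<Sigma> X us A" "is_path C \<Sigma> A p B" "is_path C \<Sigma> B vs Y"
  shows "frac (X, us @ p @ vs, Y) = frac (X, us @ q @ vs, Y)"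
  using move_step[OF assms] step_in_seqs frac_eq_iff step_equiv by blast

section \<open>The localization as a category\<close>

lemma Loc_Arr: "\<phi> \<in> Arr Loc \<longleftrightarrow> (\<exists>X ls Y. is_path C \<Sigma> X ls Y \<and> \<phi> = frac (X, ls, Y))"
  by (fastforce simp: localization_def quotient_def frac_of_def seqs_def)

lemma Loc_ArrI: "is_path C \<Sigma> X ls Y \<Longrightarrow> frac (X, ls, Y) \<in> Arr Loc"
  using Loc_Arr by blast

lemma Loc_ArrE:
  assumes "\<phi> \<in> Arr Loc"
  obtains X ls Y where "is_path C \<Sigma> X ls Y" "\<phi> = frac (X, ls, Y)"
  using assms Loc_Arr by blast

lemma Loc_Obj [simp]: "Obj Loc = Obj C"
  by (simp add: localization_def)

lemma frac_member:
  assumes "is_path C \<Sigma> X ls Y" "s \<in> frac (X, ls, Y)"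
  obtains ls' where "s = (X, ls', Y)" "is_path C \<Sigma> X ls' Y" "frac (X, ls', Y) = frac (X, ls, Y)"
  using assms frac_eq_ends by (cases s) (fastforce simp: in_frac)

lemma self_in_frac: "is_path C \<Sigma> X ls Y \<Longrightarrow> (X, ls, Y) \<in> frac (X, ls, Y)"
  by (simp add: in_frac)

lemma frac_member_ends:
  "is_path C \<Sigma> X ls Y \<Longrightarrow> s \<in> frac (X, ls, Y) \<Longrightarrow> fst s = X \<and> snd (snd s) = Y"
  by (auto elim: frac_member)

lemma Loc_Dom [simp]:
  assumes "is_path C \<Sigma> X ls Y" shows "Dom Loc (frac (X, ls, Y)) = X"
proof -
  have "(THE Z. \<exists>s\<in>frac (X, ls, Y). fst s = Z) = X"
  proof (rule the_equality)
    show "\<exists>s\<in>frac (X, ls, Y). fst s = X"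
      using self_in_frac[OF assms] by (rule bexI[rotated]) simp
  qed (use frac_member_ends[OF assms] in blast)
  then show ?thesis by (simp add: localization_def)
qed

lemma Loc_Cod [simp]:
  assumes "is_path C \<Sigma> X ls Y" shows "Cod Loc (frac (X, ls, Y)) = Y"
proof -
  have "(THE Z. \<exists>s\<in>frac (X, ls, Y). snd (snd s) = Z) = Y"
  proof (rule the_equality)
    show "\<exists>s\<in>frac (X, ls, Y). snd (snd s) = Y"
      using self_in_frac[OF assms] by (rule bexI[rotated]) simp
  qed (use frac_member_ends[OF assms] in blast)
  then show ?thesis by (simp add: localization_def)
qed

lemma Loc_Ide: "Ide Loc X = frac (X, [], X)"
  by (simp add: localization_def)

text \<open>Two uses of \<open>frac_context\<close>: first \<open>us\<close> is replaced in front of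
  \<open>vs\<close>, then \<open>vs\<close> is replaced behind \<open>us'\<close>.\<close>

lemma frac_append:
  assumes "is_path C \<Sigma> X us Y" "is_path C \<Sigma> X us' Y" "frac (X, us, Y) = frac (X, us', Y)"
    and "is_path C \<Sigma> Y vs Z" "is_path C \<Sigma> Y vs' Z" "frac (Y, vs, Z) = frac (Y, vs', Z)"
  shows "frac (X, us @ vs, Z) = frac (X, us' @ vs', Z)"
proof -
  have "is_path C \<Sigma> X [] X" "is_path C \<Sigma> Z [] Z" using assms path_ends by auto
  then show ?thesis
    using frac_context[of X us Y us' X "[]" vs Z] frac_context[of Y vs Z vs' X us' "[]" Z] assms
    by simp
qed

text \<open>The union defining \<open>Comp\<close> runs over equal classes by
  \<open>frac_append\<close>, so composition can be computed on any representatives.\<close>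

lemma Loc_Comp:
  assumes us: "is_path C \<Sigma> X us Y" and vs: "is_path C \<Sigma> Y vs Z"
  shows "Comp Loc (frac (Y, vs, Z)) (frac (X, us, Y)) = frac (X, us @ vs, Z)"
proof -
  have eq: "frac (seq_append s t) = frac (X, us @ vs, Z)"
    if s: "s \<in> frac (X, us, Y)" and t: "t \<in> frac (Y, vs, Z)" for s t
  proof -
    obtain us' where us': "s = (X, us', Y)" "is_path C \<Sigma> X us' Y" "frac (X, us', Y) = frac (X, us, Y)"
      using us s by (rule frac_member)
    obtain vs' where vs': "t = (Y, vs', Z)" "is_path C \<Sigma> Y vs' Z" "frac (Y, vs', Z) = frac (Y, vs, Z)"
      using vs t by (rule frac_member)
    show ?thesis
      using frac_append[OF us'(2) us us'(3) vs'(2) vs vs'(3)] us'(1) vs'(1) by simp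
  qed
  \<comment> \<open>Both index sets must be inhabited for the union of a constant family to be that
    constant.\<close>
  have "frac (X, us, Y) \<noteq> {}" "frac (Y, vs, Z) \<noteq> {}"
    using self_in_frac us vs by blast+
  then have "(\<Union>s\<in>frac (X, us, Y). \<Union>t\<in>frac (Y, vs, Z). frac (seq_append s t)) = frac (X, us @ vs, Z)"
    by (simp add: eq cong: SUP_cong)
  then show ?thesis
    by (simp add: localization_def)
qed

text \<open>On representatives composition is concatenation, so associativity and units come from
  \<open>@\<close> and \<open>[]\<close>.\<close>

lemma category_Loc: "category Loc"
proof
  fix X assume "X \<in> Obj Loc"
  then have *: "is_path C \<Sigma> X [] X" by simp
  show "Ide Loc X \<in> Arr Loc" "Dom Loc (Ide Loc X) = X" "Cod Loc (Ide Loc X) = X"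
    using * by (auto simp: Loc_Ide intro: Loc_ArrI simp del: is_path.simps)
next
  fix f assume "f \<in> Arr Loc"
  then obtain X us Y where f: "is_path C \<Sigma> X us Y" "f = frac (X, us, Y)" by (rule Loc_ArrE)
  have e: "is_path C \<Sigma> X [] X" "is_path C \<Sigma> Y [] Y" using path_ends f by auto
  show "Dom Loc f \<in> Obj Loc" "Cod Loc f \<in> Obj Loc"
    using f path_ends by auto
  show "Comp Loc f (Ide Loc (Dom Loc f)) = f" "Comp Loc (Ide Loc (Cod Loc f)) f = f"
    using Loc_Comp[OF e(1) f(1)] Loc_Comp[OF f(1) e(2)] f by (simp_all add: Loc_Ide)
  fix g assume "g \<in> Arr Loc" "Cod Loc f = Dom Loc g"
  then obtain vs Z where g: "is_path C \<Sigma> Y vs Z" "g = frac (Y, vs, Z)"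
    using f by (metis Loc_ArrE Loc_Cod Loc_Dom)
  note p = path_appendI[OF f(1) g(1)]
  show "Comp Loc g f \<in> Arr Loc" "Dom Loc (Comp Loc g f) = Dom Loc f"
      "Cod Loc (Comp Loc g f) = Cod Loc g"
    using p Loc_ArrI[OF p] f g Loc_Comp[OF f(1) g(1)] by auto
  fix h assume "h \<in> Arr Loc" "Cod Loc g = Dom Loc h"
  then obtain ws V where h: "is_path C \<Sigma> Z ws V" "h = frac (Z, ws, V)"
    using g by (metis Loc_ArrE Loc_Cod Loc_Dom)
  show "Comp Loc h (Comp Loc g f) = Comp Loc (Comp Loc h g) f"
    using Loc_Comp[OF f(1) g(1)] Loc_Comp[OF g(1) h(1)] Loc_Comp[OF p h(1)]
      Loc_Comp[OF f(1) path_appendI[OF g(1) h(1)]] f g h by simp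
qed

section \<open>The localization functor and what it inverts\<close>

lemma L_ob: "X \<in> Obj C \<Longrightarrow> ob_map L X = X"
  and L_arr: "a \<in> Arr C \<Longrightarrow> arr_map L a = frac (Dom C a, [Fwd a], Cod C a)"
  by (simp_all add: localization_functor_def)

lemma frac_Ide:
  assumes "X \<in> Obj C" shows "frac (X, [Fwd (Ide C X)], X) = frac (X, [], X)"
  using frac_move[OF move_Ide[of X], of X "[]" X X "[]" X] assms
  by (simp add: Ide_in Dom_Ide Cod_Ide)

lemma is_functor_L: "is_functor C Loc L"
proof -
  have "arr_map L (Comp C g f) = Comp Loc (arr_map L g) (arr_map L f)"
    if "f \<in> Arr C" "g \<in> Arr C" "Cod C f = Dom C g" for f g
  proof -
    have "frac (Dom C f, [Fwd f, Fwd g], Cod C g) = frac (Dom C f, [Fwd (Comp C g f)], Cod C g)"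
      using frac_move[OF move_comp[of f _ g], of "Dom C f" "[]" "Dom C f" "Cod C g" "[]" "Cod C g"] that
      by (simp add: Dom_in Cod_in)
    then show ?thesis
      using Loc_Comp[OF path_Fwd[of f], of "[Fwd g]" "Cod C g"] path_Fwd[of g] that
      by (simp add: L_arr Comp_in Dom_Comp Cod_Comp)
  qed
  moreover have "ob_map L \<in> Obj C \<rightarrow>\<^sub>E Obj Loc" "arr_map L \<in> Arr C \<rightarrow>\<^sub>E Arr Loc"
    by (auto simp: localization_functor_def intro: Loc_ArrI path_Fwd simp del: is_path.simps)
  ultimately show ?thesis
    unfolding is_functor_def
    by (simp add: L_ob L_arr Dom_in Cod_in Ide_in Dom_Ide Cod_Ide path_Fwd frac_Ide Loc_Ide
        del: is_path.simps)
qed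

lemma path_Bwd: "s \<in> \<Sigma> \<Longrightarrow> is_path C \<Sigma> (Cod C s) [Bwd s] (Dom C s)"
  using \<Sigma>_arr by (auto simp: Dom_in)

text \<open>The moves \<open>move_Fwd_Bwd\<close> and \<open>move_Bwd_Fwd\<close> are the two
  equations of an inverse pair.\<close>

lemma L_inverts:
  assumes s: "s \<in> \<Sigma>"
  shows "inverse_arrows Loc (arr_map L s) (frac (Cod C s, [Bwd s], Dom C s))"
proof -
  have a: "s \<in> Arr C" using assms \<Sigma>_arr by auto
  have "frac (Dom C s, [Fwd s, Bwd s], Dom C s) = frac (Dom C s, [], Dom C s)"
    using frac_move[OF move_Fwd_Bwd[OF s], of "Dom C s" "[]" "Dom C s" "Dom C s" "[]" "Dom C s"] s a
    by (simp add: Dom_in Cod_in)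
  moreover have "frac (Cod C s, [Bwd s, Fwd s], Cod C s) = frac (Cod C s, [], Cod C s)"
    using frac_move[OF move_Bwd_Fwd[OF s], of "Cod C s" "[]" "Cod C s" "Cod C s" "[]" "Cod C s"] s a
    by (simp add: Dom_in Cod_in)
  ultimately show ?thesis
    using Loc_Comp[OF path_Fwd[OF a] path_Bwd[OF s]] Loc_Comp[OF path_Bwd[OF s] path_Fwd[OF a]]
      Loc_ArrI[OF path_Fwd[OF a]] Loc_ArrI[OF path_Bwd[OF s]] path_Fwd[OF a] path_Bwd[OF s] a
    by (simp add: inverse_arrows_def L_arr Loc_Ide del: is_path.simps)
qed

text \<open>\<open>L\<close> makes \<open>s\<close> invertible, hence cancellable, and faithfulness
  brings the resulting equality back to \<open>C\<close>. Applied to a regular target, this makes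
  the images of the denominators monic.\<close>

lemma L_monic:
  assumes "faithful_functor C L" "s \<in> \<Sigma>" "x \<in> Arr C" "y \<in> Arr C"
    and "Cod C x = Dom C s" "Cod C y = Dom C s" "Comp C s x = Comp C s y"
  shows "x = y"
proof -
  have s: "s \<in> Arr C" using assms(2) \<Sigma>_arr by auto
  have "arr_map L x = arr_map L y"
  proof (rule inverse_arrows_cancel[OF category_Loc L_inverts[OF assms(2)]])
    show "Comp Loc (arr_map L s) (arr_map L x) = Comp Loc (arr_map L s) (arr_map L y)"
      using functor_Comp[OF is_functor_L, of _ s] assms s by metis
  qed (use assms s in \<open>simp_all add: functor_simps[OF is_functor_L]\<close>)
  \<comment> \<open>\<open>faithful_functor\<close> compares parallel arrows only; the common domain
    is read off from the two equal composites.\<close>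
  moreover have "Dom C x = Dom C y"
    using Dom_Comp[OF assms(3) s] Dom_Comp[OF assms(4) s] assms by simp
  ultimately show ?thesis
    using assms unfolding faithful_functor_def by simp
qed

section \<open>Lifting a functor that inverts \<Sigma> to the localization\<close>

context
  fixes E :: "('p, 'q) cat" and G :: "('o, 'm, 'p, 'q) functr" and r :: "'m \<Rightarrow> 'q"
  assumes E: "category E" and G: "is_functor C E G"
    and r: "\<And>s. s \<in> \<Sigma> \<Longrightarrow> inverse_arrows E (arr_map G s) (r s)"
begin

interpretation E: category E by (rule E)

abbreviation "val Y \<equiv> path_val E (line_val G r) (ob_map G Y)"

lemma line_val_arr:
  "l \<in> lines C \<Sigma> \<Longrightarrow> line_val G r l \<in> Arr E \<and>
     Dom E (line_val G r l) = ob_map G (line_dom C l) \<and>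
     Cod E (line_val G r l) = ob_map G (line_cod C l)"
  using r \<Sigma>_arr by (cases l) (auto simp: functor_simps[OF G] inverse_arrows_def)

lemma val_arr:
  "is_path C \<Sigma> X ls Y \<Longrightarrow>
     val Y ls \<in> Arr E \<and> Dom E (val Y ls) = ob_map G X \<and> Cod E (val Y ls) = ob_map G Y"
  by (induction ls arbitrary: X)
    (auto simp: line_val_arr functor_ob[OF G] E.Ide_in E.Dom_Ide E.Cod_Ide
      E.Comp_in E.Dom_Comp E.Cod_Comp)

lemma val_append:
  "is_path C \<Sigma> X us Y \<Longrightarrow> is_path C \<Sigma> Y vs Z \<Longrightarrow>
     val Z (us @ vs) = Comp E (val Z vs) (val Y us)"
proof (induction us arbitrary: X)
  case Nil
  then show ?case using val_arr[of Y vs Z] E.Comp_Ide_right[of "val Z vs"] by auto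
next
  case (Cons l us)
  then show ?case
    using Cons.IH[of "line_cod C l"] line_val_arr[of l] val_arr[of "line_cod C l" us Y] val_arr[of Y vs Z]
      E.Comp_assoc[of "line_val G r l" "val Y us" "val Z vs"]
    by simp
qed

text \<open>Removes the identity that the empty tail contributes to the value of a one-line
  word.\<close>

lemma Comp_Ide_arr_map:
  "a \<in> Arr C \<Longrightarrow> Comp E (Ide E (ob_map G (Cod C a))) (arr_map G a) = arr_map G a"
  using E.Comp_Ide_left[OF functor_arr[OF G]] by (simp add: functor_Cod[OF G])

text \<open>Each move becomes an equation valid in \<open>E\<close>: functoriality of
  \<open>G\<close> for \<open>move_comp\<close> and \<open>move_Ide\<close>, the inverse laws of
  \<open>r\<close> for the other two.\<close>

lemma val_move:
  "move C \<Sigma> p q \<Longrightarrow> is_path C \<Sigma> X p Y \<Longrightarrow> val Y p = val Y q"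
proof (induction rule: move.induct)
  case (move_comp a a')
  then show ?case
    using Comp_Ide_arr_map[of a'] Comp_Ide_arr_map[of "Comp C a' a"]
    by (auto simp: functor_Comp[OF G] Comp_in Cod_Comp)
next
  case (move_Bwd_Fwd s)
  then show ?case
    using r[of s] \<Sigma>_arr E.Comp_Ide_left[of "arr_map G s"]
    by (auto simp: inverse_arrows_def functor_simps[OF G])
next
  case (move_Fwd_Bwd s)
  then show ?case
    using r[of s] \<Sigma>_arr E.Comp_Ide_left[of "r s"]
    by (auto simp: inverse_arrows_def functor_simps[OF G])
next
  case (move_Ide X)
  then show ?case
    using E.Comp_Ide_left[OF functor_arr[OF G, of "Ide C X"]]
    by (auto simp: functor_simps[OF G] Ide_in Cod_Ide)
qed

text \<open>\<open>val_append\<close> isolates the replaced part, where \<open>val_move\<close>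
  applies. Codomains are tracked because \<open>val\<close> takes the codomain as an
  argument.\<close>

lemma val_equiv:
  "(s, t) \<in> seq_equiv C \<Sigma> \<Longrightarrow>
     snd (snd s) = snd (snd t) \<and> val (snd (snd s)) (fst (snd s)) = val (snd (snd t)) (fst (snd t))"
proof (induction rule: seq_equiv_induct)
  case (step s t)
  then obtain X us A p q B vs Y where s: "s = (X, us @ p @ vs, Y)" "t = (X, us @ q @ vs, Y)"
    and p: "move C \<Sigma> p q" "is_path C \<Sigma> X us A" "is_path C \<Sigma> A p B" "is_path C \<Sigma> B vs Y"
    by (rule seq_stepE)
  note q = move_path[OF p(1,3)]
  show ?case
    using val_append[OF p(2) path_appendI[OF p(3,4)]] val_append[OF p(2) path_appendI[OF q p(4)]]
      val_append[OF p(3,4)] val_append[OF q p(4)] val_move[OF p(1,3)] s by simp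
qed auto

lemma val_lift: "\<exists>H. is_functor Loc E H \<and> comp_functor C H L = G"
proof -
  define v where "v s = val (snd (snd s)) (fst (snd s))" for s :: "('o, 'm) seq"
  \<comment> \<open>Some representative is evaluated; by \<open>val_equiv\<close> the choice does
    not matter.\<close>
  define h where "h \<phi> = v (SOME s. s \<in> \<phi>)" for \<phi>
  have h: "h (frac (X, ls, Y)) = val Y ls" if "is_path C \<Sigma> X ls Y" for X ls Y
  proof -
    have "(SOME s. s \<in> frac (X, ls, Y)) \<in> frac (X, ls, Y)"
      using self_in_frac[OF that] by (rule someI)
    then have "((X, ls, Y), SOME s. s \<in> frac (X, ls, Y)) \<in> seq_equiv C \<Sigma>"
      by (simp add: frac_of_def)
    from val_equiv[OF this] show ?thesis by (simp add: h_def v_def)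
  qed
  define H where "H = ((\<lambda>X\<in>Obj C. ob_map G X), (\<lambda>\<phi>\<in>Arr Loc. h \<phi>))"
  have H_ob: "ob_map H X = ob_map G X" if "X \<in> Obj C" for X
    using that by (simp add: H_def)
  have H_arr: "arr_map H (frac (X, ls, Y)) = val Y ls" if "is_path C \<Sigma> X ls Y" for X ls Y
    using h that Loc_ArrI by (simp add: H_def)
  have "is_functor Loc E H"
    unfolding is_functor_def
  proof (intro conjI ballI impI)
    show "ob_map H \<in> Obj Loc \<rightarrow>\<^sub>E Obj E" by (auto simp: H_def functor_ob[OF G])
    show "arr_map H \<in> Arr Loc \<rightarrow>\<^sub>E Arr E"
      using h val_arr by (auto simp: H_def Loc_Arr)
  next
    fix X assume "X \<in> Obj Loc"
    then show "arr_map H (Ide Loc X) = Ide E (ob_map H X)"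
      using H_arr[of X "[]" X] by (simp add: Loc_Ide H_ob)
  next
    fix f assume "f \<in> Arr Loc"
    then obtain X us Y where f: "is_path C \<Sigma> X us Y" "f = frac (X, us, Y)" by (rule Loc_ArrE)
    show "Dom E (arr_map H f) = ob_map H (Dom Loc f)" "Cod E (arr_map H f) = ob_map H (Cod Loc f)"
      using f val_arr[OF f(1)] path_ends[OF f(1)] by (simp_all add: H_ob H_arr)
    fix g assume "g \<in> Arr Loc" "Cod Loc f = Dom Loc g"
    then obtain vs Z where g: "is_path C \<Sigma> Y vs Z" "g = frac (Y, vs, Z)"
      using f by (metis Loc_ArrE Loc_Cod Loc_Dom)
    show "arr_map H (Comp Loc g f) = Comp E (arr_map H g) (arr_map H f)"
      using Loc_Comp[OF f(1) g(1)] path_appendI[OF f(1) g(1)] val_append[OF f(1) g(1)] f g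
      by (simp add: H_arr)
  qed
  moreover have "arr_map H (arr_map L a) = arr_map G a" if "a \<in> Arr C" for a
    using that H_arr[OF path_Fwd[OF that]] E.Comp_Ide_left[OF functor_arr[OF G that]]
    by (simp add: L_arr functor_Cod[OF G])
  then have "comp_functor C H L = G"
    using is_functor_comp[OF category_axioms is_functor_L \<open>is_functor Loc E H\<close>] G
    by (intro functor_eqI[of C E])
      (simp_all add: comp_functor_ob comp_functor_arr L_ob H_ob)
  ultimately show ?thesis by blast
qed

end

lemma localization_lift:
  assumes "category E" "is_functor C E G"
    and "\<And>s. s \<in> \<Sigma> \<Longrightarrow> \<exists>g. inverse_arrows E (arr_map G s) g"
  obtains H where "is_functor Loc E H" "comp_functor C H L = G"
proof -
  obtain r where "\<And>s. s \<in> \<Sigma> \<Longrightarrow> inverse_arrows E (arr_map G s) (r s)"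
    using assms(3) by metis
  from val_lift[OF assms(1,2) this] that show thesis by blast
qed

text \<open>\<open>G\<close> factors through \<open>L\<close>, so it cannot separate arrows that
  \<open>L\<close> identifies. For \<open>G\<close> injective on arrows this makes \<open>L\<close>
  faithful.\<close>

lemma L_eq_imp_eq:
  assumes "category E" "is_functor C E G"
    and "\<And>s. s \<in> \<Sigma> \<Longrightarrow> \<exists>g. inverse_arrows E (arr_map G s) g"
    and "f \<in> Arr C" "g \<in> Arr C" "arr_map L f = arr_map L g"
  shows "arr_map G f = arr_map G g"
proof -
  obtain H where "comp_functor C H L = G"
    using assms(1-3) by (rule localization_lift)
  then show ?thesis
    using comp_functor_arr[OF assms(4), of H L] comp_functor_arr[OF assms(5), of H L] assms(6) by metis
qed

end

section \<open>The dilatation\<close>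

locale dilating = category C for C :: "('o, 'm) cat" +
  fixes I :: "'i set" and N :: "'i \<Rightarrow> 'm set" and d :: "'i \<Rightarrow> 'm"
  assumes center: "center C I N d"
begin

section \<open>Arrows of the dilatation as words\<close>

lemma d_arr: "i \<in> I \<Longrightarrow> d i \<in> Arr C"
  and N_arr: "i \<in> I \<Longrightarrow> n \<in> N i \<Longrightarrow> n \<in> Arr C"
  and N_Cod: "i \<in> I \<Longrightarrow> n \<in> N i \<Longrightarrow> Cod C n = Cod C (d i)"
  and N_Comp: "i \<in> I \<Longrightarrow> n \<in> N i \<Longrightarrow> m \<in> Arr C \<Longrightarrow> Cod C m = Dom C n \<Longrightarrow> Comp C n m \<in> N i"
  using center unfolding center_def sieve_over_def sieve_def by blast+

sublocale localizing C "d ` I"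
  by unfold_locales (auto simp: d_arr)

sublocale Loc: category Loc
  by (rule category_Loc)

abbreviation "Dil \<equiv> dilatation C I N d"
abbreviation "\<Theta> \<equiv> dilatation_functor C I d"

text \<open>The part of a standard representative before its final arrow, split off so that
  inductions can run over the pairs.\<close>

definition word :: "('i \<times> 'm) list \<Rightarrow> 'm line list" where
  "word ps = concat (map (\<lambda>(i, n). [Fwd n, Bwd (d i)]) ps)"

lemma word_simps [simp]: "word [] = []" "word ((i, n) # ps) = Fwd n # Bwd (d i) # word ps"
  by (simp_all add: word_def)

text \<open>The two functors differ only in the category taken as target, so computations with
  \<open>L\<close> serve for \<open>\<Theta>\<close>.\<close>

lemma \<Theta>_eq_L: "\<Theta> = L"
  by (simp add: dilatation_functor_def localization_functor_def)

lemma Dil_simps [simp]: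
  "Obj Dil = Obj C" "Dom Dil = Dom Loc" "Cod Dil = Cod Loc" "Ide Dil = Ide Loc" "Comp Dil = Comp Loc"
  by (simp_all add: dilatation_def localization_def)

lemma Dil_ArrI:
  assumes "set ps \<subseteq> Sigma I N" "a \<in> Arr C" "is_path C (d ` I) X (word ps @ [Fwd a]) Y"
  shows "frac (X, word ps @ [Fwd a], Y) \<in> Arr Dil"
proof -
  have "\<forall>(i, n)\<in>set ps. i \<in> I \<and> n \<in> N i" using assms(1) by auto
  moreover have "(X, word ps @ [Fwd a], Y) \<in> seqs C (d ` I)" using assms(3) by (simp only: seqs_iff)
  ultimately have "(X, word ps @ [Fwd a], Y) \<in> standard_seqs C I N d"
    using assms(2) unfolding standard_seqs_def word_def by blast
  then show ?thesis by (simp add: dilatation_def)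
qed

lemma Dil_ArrE:
  assumes "\<phi> \<in> Arr Dil"
  obtains X ps a Y where "set ps \<subseteq> Sigma I N" "a \<in> Arr C"
    "is_path C (d ` I) X (word ps @ [Fwd a]) Y" "\<phi> = frac (X, word ps @ [Fwd a], Y)"
proof -
  obtain s where s: "s \<in> standard_seqs C I N d" "\<phi> = frac s"
    using assms by (auto simp: dilatation_def)
  from s(1) obtain X Y ps a where "s = (X, word ps @ [Fwd a], Y)"
    "\<forall>(i, n)\<in>set ps. i \<in> I \<and> n \<in> N i" "a \<in> Arr C" "s \<in> seqs C (d ` I)"
    unfolding standard_seqs_def word_def by blast
  then show thesis using s(2) by (intro that[of ps a X Y]) auto
qed

lemma Dil_Loc: "\<phi> \<in> Arr Dil \<Longrightarrow> \<phi> \<in> Arr Loc"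
  by (elim Dil_ArrE) (simp add: Loc_ArrI)

section \<open>Elementary fractions: a numerator followed by a formal inverse\<close>

definition quot :: "'i \<Rightarrow> 'm \<Rightarrow> ('o, 'm) frac" where
  "quot i n = Comp Loc (frac (Cod C (d i), [Bwd (d i)], Dom C (d i))) (arr_map L n)"

context
  fixes i n assumes i: "i \<in> I" and n: "n \<in> N i"
begin

lemma quot_path: "is_path C (d ` I) (Dom C n) [Fwd n, Bwd (d i)] (Dom C (d i))"
  using i n by (simp add: N_arr N_Cod d_arr Dom_in)

lemma quot_eq: "quot i n = frac (Dom C n, [Fwd n, Bwd (d i)], Dom C (d i))"
  using Loc_Comp[of "Dom C n" "[Fwd n]" "Cod C n" "[Bwd (d i)]" "Dom C (d i)"]
    path_Fwd[of n] path_Bwd[of "d i"] i n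
  by (simp add: quot_def L_arr N_arr N_Cod)

lemma quot_Loc: "quot i n \<in> Arr Loc"
  and Dom_quot: "Dom Loc (quot i n) = Dom C n"
  and Cod_quot: "Cod Loc (quot i n) = Dom C (d i)"
  unfolding quot_eq using Loc_ArrI[OF quot_path] Loc_Dom[OF quot_path] Loc_Cod[OF quot_path] by auto

text \<open>The formal inverse cancels against \<open>d i\<close>. This equation pins down the image
  of \<open>quot i n\<close> under functors into a regular target.\<close>

lemma L_d_quot: "Comp Loc (arr_map L (d i)) (quot i n) = arr_map L n"
proof -
  let ?l = "frac (Cod C (d i), [Bwd (d i)], Dom C (d i))"
  have inv: "inverse_arrows Loc (arr_map L (d i)) ?l"
    using L_inverts i by blast
  have n': "arr_map L n \<in> Arr Loc" "Cod Loc (arr_map L n) = Cod Loc (arr_map L (d i))"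
    using i n by (simp_all add: functor_simps[OF is_functor_L] N_arr N_Cod d_arr)
  show ?thesis
    using Loc.Comp_assoc[of "arr_map L n" ?l "arr_map L (d i)"] Loc.Comp_Ide_left[OF n'(1)] inv n'
    unfolding quot_def inverse_arrows_def by metis
qed

text \<open>By associativity \<open>b\<close> is first composed with \<open>n\<close>;
  \<open>N_Comp\<close> puts the new numerator into the same sieve.\<close>

lemma quot_L:
  assumes b: "b \<in> Arr C" "Cod C b = Dom C n"
  shows "Comp Loc (quot i n) (arr_map L b) = quot i (Comp C n b)"
  using Loc.Comp_assoc[of "arr_map L b" "arr_map L n" "frac (Cod C (d i), [Bwd (d i)], Dom C (d i))"]
    path_Bwd[of "d i"] Loc_ArrI[OF path_Bwd[of "d i"]] i n b
  by (simp add: quot_def functor_simps[OF is_functor_L] N_arr N_Cod L_ob Cod_in d_arr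
        del: is_path.simps)

text \<open>The pair \<open>(i, n)\<close> is put in front of the word of \<phi>, since the right
  factor of a composite is traversed first.\<close>

lemma Dil_Comp_quot:
  assumes "\<phi> \<in> Arr Dil" "Dom Loc \<phi> = Dom C (d i)"
  shows "Comp Loc \<phi> (quot i n) \<in> Arr Dil"
proof -
  obtain X ps a Y where ps: "set ps \<subseteq> Sigma I N" "a \<in> Arr C"
    and p: "is_path C (d ` I) X (word ps @ [Fwd a]) Y" and \<phi>: "\<phi> = frac (X, word ps @ [Fwd a], Y)"
    using assms(1) by (rule Dil_ArrE)
  have X: "X = Dom C (d i)" using Loc_Dom[OF p] assms(2) \<phi> by simp
  have "Comp Loc \<phi> (quot i n) = frac (Dom C n, word ((i, n) # ps) @ [Fwd a], Y)"
    using Loc_Comp[OF quot_path p[unfolded X]] by (simp add: quot_eq \<phi> X)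
  moreover have "is_path C (d ` I) (Dom C n) (word ((i, n) # ps) @ [Fwd a]) Y"
    using path_appendI[OF quot_path p[unfolded X]] by simp
  then have "frac (Dom C n, word ((i, n) # ps) @ [Fwd a], Y) \<in> Arr Dil"
    using ps i n by (intro Dil_ArrI) auto
  ultimately show ?thesis by simp
qed

end

section \<open>Induction on fractions and closure under composition\<close>

lemma L_in_Dil: "a \<in> Arr C \<Longrightarrow> arr_map L a \<in> Arr Dil"
  using Dil_ArrI[of "[]" a "Dom C a" "Cod C a"] path_Fwd[of a] by (simp add: L_arr)

text \<open>Induction on the list of pairs. The first pair of a word is the rightmost factor of the
  composite, so a step precomposes with \<open>quot i n\<close>.\<close>

lemma Dil_induct [consumes 1, case_names base step]:
  assumes "\<phi> \<in> Arr Dil"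
    and base: "\<And>a. a \<in> Arr C \<Longrightarrow> P (arr_map L a)"
    and step: "\<And>\<phi> i n. \<phi> \<in> Arr Dil \<Longrightarrow> i \<in> I \<Longrightarrow> n \<in> N i \<Longrightarrow> Dom Loc \<phi> = Dom C (d i) \<Longrightarrow>
      P \<phi> \<Longrightarrow> P (Comp Loc \<phi> (quot i n))"
  shows "P \<phi>"
proof -
  have "P (frac (X, word ps @ [Fwd a], Y))"
    if "set ps \<subseteq> Sigma I N" "a \<in> Arr C" "is_path C (d ` I) X (word ps @ [Fwd a]) Y"
    for X ps a Y
    using that
  proof (induction ps arbitrary: X)
    case Nil
    then show ?case using base[of a] by (auto simp: L_arr)
  next
    case (Cons p ps)
    obtain i n where p: "p = (i, n)" by (cases p)
    have i: "i \<in> I" "n \<in> N i" using Cons.prems p by auto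
    have X: "X = Dom C n" and path: "is_path C (d ` I) (Dom C (d i)) (word ps @ [Fwd a]) Y"
      using Cons.prems p by auto
    have "P (Comp Loc (frac (Dom C (d i), word ps @ [Fwd a], Y)) (quot i n))"
      using Cons.IH[OF _ _ path] Cons.prems path Loc_Dom[OF path] i
      by (intro step Dil_ArrI) auto
    then show ?case
      using Loc_Comp[OF quot_path[OF i] path] by (simp add: p X quot_eq[OF i])
  qed
  then show ?thesis using assms(1) by (elim Dil_ArrE) simp
qed

text \<open>The word of \<open>quot i n\<close> ends in a formal inverse, while a standard
  representative ends in an arrow of \<open>C\<close>; the identity at \<open>Dom C (d i)\<close>
  supplies that arrow.\<close>

lemma quot_in_Dil:
  assumes "i \<in> I" "n \<in> N i" shows "quot i n \<in> Arr Dil"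
proof -
  have X: "Dom C (d i) \<in> Obj C" using assms by (simp add: d_arr Dom_in)
  have "Comp Loc (arr_map L (Ide C (Dom C (d i)))) (quot i n) \<in> Arr Dil"
    using X assms by (intro Dil_Comp_quot L_in_Dil)
      (simp_all add: Ide_in Dom_Ide functor_Dom[OF is_functor_L] L_ob)
  then show ?thesis
    using Loc.Comp_Ide_left[OF quot_Loc[OF assms]] X
    by (simp add: functor_Ide[OF is_functor_L] L_ob Cod_quot[OF assms])
qed

text \<open>Precomposing \<open>l\<^sub>d \<circ> n\<close> with a morphism only changes \<open>n\<close> within its sieve, so a
  morphism in the middle of a word is absorbed by the next numerator.\<close>

lemma Dil_Comp_L:
  assumes "\<phi> \<in> Arr Dil" "b \<in> Arr C" "Cod C b = Dom Loc \<phi>"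
  shows "Comp Loc \<phi> (arr_map L b) \<in> Arr Dil"
  using assms(1,3)
proof (induction rule: Dil_induct)
  case (base a)
  have a: "Cod C b = Dom C a"
    using base by (simp add: functor_Dom[OF is_functor_L] L_ob Dom_in)
  then show ?case
    using L_in_Dil[of "Comp C a b"] base(1) assms(2)
    by (simp add: functor_Comp[OF is_functor_L] Comp_in)
next
  case (step \<phi> i n)
  note q = quot_Loc[OF step(2,3)] Dom_quot[OF step(2,3)] Cod_quot[OF step(2,3)]
  have b: "Cod C b = Dom C n"
    using step q by (simp add: Loc.Dom_Comp Dil_Loc)
  have Lb: "arr_map L b \<in> Arr Loc" "Cod Loc (arr_map L b) = Dom Loc (quot i n)"
    using assms(2) b q by (simp_all add: functor_simps[OF is_functor_L] L_ob Cod_in)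
       (metis L_ob Cod_in)
  have "Comp Loc (Comp Loc \<phi> (quot i n)) (arr_map L b) = Comp Loc \<phi> (quot i (Comp C n b))"
    using Loc.Comp_assoc[OF Lb(1) q(1) Dil_Loc[OF step(1)]] Lb q step(4) quot_L[OF step(2,3) assms(2) b]
    by simp
  then show ?case
    using Dil_Comp_quot[OF step(2) N_Comp[OF step(2,3) assms(2) b] step(1,4)] by simp
qed

text \<open>Induction on the factor \<phi> traversed first: an arrow of \<open>C\<close> is absorbed
  by \<open>Dil_Comp_L\<close>, and a rightmost \<open>quot i n\<close> is split off by
  associativity and put back by \<open>Dil_Comp_quot\<close>.\<close>

lemma Dil_Comp:
  assumes "\<phi> \<in> Arr Dil" "\<psi> \<in> Arr Dil" "Cod Loc \<phi> = Dom Loc \<psi>"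
  shows "Comp Loc \<psi> \<phi> \<in> Arr Dil"
  using assms(1,3)
proof (induction rule: Dil_induct)
  case (base a)
  then show ?case
    using assms(2) by (intro Dil_Comp_L) (simp_all add: functor_Cod[OF is_functor_L] L_ob Cod_in)
next
  case (step \<phi> i n)
  note q = quot_Loc[OF step(2,3)] Dom_quot[OF step(2,3)] Cod_quot[OF step(2,3)]
  note \<phi> = Dil_Loc[OF step(1)] and \<psi> = Dil_Loc[OF assms(2)]
  have c: "Cod Loc \<phi> = Dom Loc \<psi>"
    using Loc.Cod_Comp[OF q(1) \<phi>] q step by simp
  have "Comp Loc \<psi> (Comp Loc \<phi> (quot i n)) = Comp Loc (Comp Loc \<psi> \<phi>) (quot i n)"
    using Loc.Comp_assoc[OF q(1) \<phi> \<psi>] q step(4) c by simp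
  moreover have "Comp Loc (Comp Loc \<psi> \<phi>) (quot i n) \<in> Arr Dil"
    using step(2,3,4) step(5)[OF c] Loc.Dom_Comp[OF \<phi> \<psi> c] by (intro Dil_Comp_quot) auto
  ultimately show ?case by simp
qed

section \<open>The dilatation as a regular object under \<open>C\<close>\<close>

lemma Ide_in_Dil: "X \<in> Obj C \<Longrightarrow> Ide Loc X \<in> Arr Dil"
  using L_in_Dil[of "Ide C X"] by (simp add: functor_Ide[OF is_functor_L] L_ob Ide_in)

text \<open>The operations are those of \<open>Loc\<close>, so the equations are inherited and
  closure under identities and composites remains.\<close>

lemma category_Dil: "category Dil"
  by unfold_locales
    (auto simp: Ide_in_Dil Dil_Comp Loc.Dom_Comp Loc.Cod_Comp Loc.Comp_Ide_right Loc.Comp_Ide_left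
      Loc.Comp_assoc Loc.Dom_Ide Loc.Cod_Ide
      intro: Loc.Dom_in[simplified] Loc.Cod_in[simplified] dest!: Dil_Loc)

lemma is_functor_\<Theta>: "is_functor C Dil \<Theta>"
proof -
  have "arr_map L \<in> Arr C \<rightarrow>\<^sub>E Arr Dil"
    using is_functor_L L_in_Dil unfolding is_functor_def by auto
  then show ?thesis
    using is_functor_L unfolding is_functor_def \<Theta>_eq_L by simp
qed

text \<open>Arrows of \<open>Dil\<close> are themselves classes in \<open>Loc\<close>, so the
  identity pair of \<open>Dil\<close> doubles as the inclusion.\<close>

lemma is_functor_inclusion: "is_functor Dil Loc (id_functor Dil)"
  unfolding is_functor_def id_functor_def
  by (auto simp: Dil_Loc Ide_in_Dil Dil_Comp Loc.Dom_in[simplified] Loc.Cod_in[simplified])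

text \<open>The inclusion of the dilatation into \<open>C[\<Sigma>\<^sup>-\<^sup>1]\<close> inverts \<open>\<Theta>(\<Sigma>)\<close>, hence factors through
  the localization of the dilatation at \<open>\<Theta>(\<Sigma>)\<close>.\<close>

lemma \<Theta>_regular: "(Dil, \<Theta>) \<in> reg_objs C (d ` I)"
proof -
  interpret DL: localizing Dil "arr_map \<Theta> ` d ` I"
    using category_Dil d_arr L_in_Dil
    by (intro localizing.intro localizing_axioms.intro) (auto simp: \<Theta>_eq_L)
  have "\<exists>g. inverse_arrows Loc (arr_map (id_functor Dil) s) g" if "s \<in> arr_map \<Theta> ` d ` I" for s
    using that L_inverts d_arr L_in_Dil by (fastforce simp: \<Theta>_eq_L id_functor_def)
  then have "f = g" if "f \<in> Arr Dil" "g \<in> Arr Dil" "arr_map DL.L f = arr_map DL.L g" for f g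
    using DL.L_eq_imp_eq[OF category_Loc is_functor_inclusion _ that] that(1,2)
    by (simp add: id_functor_def)
  then show ?thesis
    using category_Dil is_functor_\<Theta> unfolding reg_objs_def faithful_functor_def by auto
qed

section \<open>Functors out of the dilatation: necessity of the sieve condition, uniqueness,
  existence\<close>

lemma under_hom_imp_sieves:
  assumes D: "category D" and F: "is_functor C D F" and K: "K \<in> under_hom C (Dil, \<Theta>) (D, F)" and i: "i \<in> I"
  shows "gen_sieve D (arr_map F ` N i) \<subseteq> gen_sieve D {arr_map F (d i)}"
proof
  interpret D: category D by fact
  fix x assume "x \<in> gen_sieve D (arr_map F ` N i)"
  then obtain n m where n: "n \<in> N i" and m: "m \<in> Arr D" "Cod D m = Dom D (arr_map F n)"
    and x: "x = Comp D (arr_map F n) m"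
    by (auto simp: gen_sieve_def)
  note q = quot_in_Dil[OF i n] Dom_quot[OF i n] Cod_quot[OF i n]
  have K: "is_functor Dil D K" "comp_functor C K L = F"
    using K by (auto simp: under_hom_def \<Theta>_eq_L)
  have FL: "arr_map F a = arr_map K (arr_map L a)" if "a \<in> Arr C" for a
    using comp_functor_arr[OF that, of K L] K(2) by simp
  have Ld: "arr_map L (d i) \<in> Arr Dil" "Dom Loc (arr_map L (d i)) = Dom C (d i)"
    using i by (simp_all add: L_in_Dil d_arr functor_Dom[OF is_functor_L] L_ob Dom_in)
  have Ln: "arr_map L n \<in> Arr Dil" "Dom Loc (arr_map L n) = Dom C n"
    using N_arr[OF i n] by (simp_all add: L_in_Dil functor_Dom[OF is_functor_L] L_ob Dom_in)
  let ?q = "arr_map K (quot i n)" and ?d = "arr_map F (d i)"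
  \<comment> \<open>Applying \<open>K\<close> to \<open>L_d_quot\<close> factors \<open>F(n)\<close>
    through \<open>F(d i)\<close>; \<open>m\<close> is then carried along by associativity.\<close>
  have e: "arr_map F n = Comp D ?d ?q"
    using functor_Comp[OF K(1) q(1) Ld(1)] q Ld L_d_quot[OF i n]
    by (simp add: FL N_arr[OF i n] d_arr[OF i])
  have 1: "?d \<in> Arr D" "?q \<in> Arr D" "Cod D ?q = Dom D ?d" "Cod D m = Dom D ?q"
    using functor_arr[OF K(1) q(1)] functor_arr[OF F d_arr[OF i]] functor_Cod[OF K(1) q(1)]
      functor_Dom[OF K(1) q(1)] functor_Dom[OF K(1) Ld(1)] functor_Dom[OF K(1) Ln(1)] q Ld Ln m
    by (simp_all add: FL[OF d_arr[OF i]] FL[OF N_arr[OF i n]])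
  have "x = Comp D ?d (Comp D ?q m)"
    using D.Comp_assoc[OF m(1) 1(2,1) 1(4,3)] x e by simp
  then show "x \<in> gen_sieve D {?d}"
    using D.Comp_in[OF m(1) 1(2) 1(4)] D.Cod_Comp[OF m(1) 1(2) 1(4)] 1(3)
    unfolding gen_sieve_def by auto
qed

text \<open>Both functors restrict to \<open>F\<close> along \<open>\<Theta>\<close>, so they agree
  on arrows from \<open>C\<close>; on \<open>quot i n\<close> they agree because
  \<open>F(d i)\<close> is monic in \<open>D\<close>. \<open>Dil_induct\<close> extends this to all
  fractions.\<close>

lemma under_hom_unique:
  assumes reg: "(D, F) \<in> reg_objs C (d ` I)"
    and K: "K \<in> under_hom C (Dil, \<Theta>) (D, F)" and K': "K' \<in> under_hom C (Dil, \<Theta>) (D, F)"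
  shows "K = K'"
proof -
  have F: "is_functor C D F" and faithful: "faithful_functor D (localization_functor D (arr_map F ` d ` I))"
    using reg by (auto simp: reg_objs_def)
  interpret D: localizing D "arr_map F ` d ` I"
    using reg functor_arr[OF F d_arr]
    by (intro localizing.intro localizing_axioms.intro) (auto simp: reg_objs_def)
  have K: "is_functor Dil D K" "comp_functor C K L = F" and K': "is_functor Dil D K'" "comp_functor C K' L = F"
    using K K' by (auto simp: under_hom_def \<Theta>_eq_L)
  have KL: "arr_map K (arr_map L a) = arr_map F a" "arr_map K' (arr_map L a) = arr_map F a" if "a \<in> Arr C" for a
    using comp_functor_arr[OF that, of K L] comp_functor_arr[OF that, of K' L] K(2) K'(2) by simp_all
  have ob: "ob_map K X = ob_map F X" "ob_map K' X = ob_map F X" if "X \<in> Obj C" for X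
    using comp_functor_ob[OF that, of K L] comp_functor_ob[OF that, of K' L] K(2) K'(2) that
    by (simp_all add: L_ob)
  show ?thesis
  proof (rule functor_eqI[OF K(1) K'(1)])
    fix X assume "X \<in> Obj Dil"
    then show "ob_map K X = ob_map K' X" by (simp add: ob)
  next
    fix \<phi> assume "\<phi> \<in> Arr Dil"
    then show "arr_map K \<phi> = arr_map K' \<phi>"
    proof (induction rule: Dil_induct)
      case (base a)
      then show ?case by (simp add: KL)
    next
      case (step \<phi> i n)
      note di = d_arr[OF step(2)]
      note q = quot_in_Dil[OF step(2,3)] Cod_quot[OF step(2,3)]
      have Ld: "arr_map L (d i) \<in> Arr Dil" "Dom Loc (arr_map L (d i)) = Dom C (d i)"
        using di by (simp_all add: L_in_Dil functor_Dom[OF is_functor_L] L_ob Dom_in)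
      have "arr_map K (quot i n) = arr_map K' (quot i n)"
      proof (rule D.L_monic[OF faithful])
        \<comment> \<open>Both sides equal \<open>F(n)\<close>, by \<open>L_d_quot\<close> and the
          restriction to \<open>F\<close>.\<close>
        show "Comp D (arr_map F (d i)) (arr_map K (quot i n)) = Comp D (arr_map F (d i)) (arr_map K' (quot i n))"
          using functor_Comp[OF K(1) q(1) Ld(1)] functor_Comp[OF K'(1) q(1) Ld(1)] q Ld
            L_d_quot[OF step(2,3)] KL[OF di] KL[OF N_arr[OF step(2,3)]] by simp
      qed (use step(2) q di in \<open>auto simp: functor_simps[OF F] functor_simps[OF K(1)]
          functor_simps[OF K'(1)] ob Dom_in\<close>)
      then show ?case
        using step(5) functor_Comp[OF K(1) q(1) step(1)] functor_Comp[OF K'(1) q(1) step(1)] q(2) step(4)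
        by simp
    qed
  qed
qed

text \<open>The functor is obtained by lifting \<open>C \<rightarrow> D \<rightarrow> D[F(\<Sigma>)\<^sup>-\<^sup>1]\<close> to \<open>C[\<Sigma>\<^sup>-\<^sup>1]\<close>: the sieve condition
  puts the image of the dilatation into the image of the faithful functor \<open>D \<rightarrow> D[F(\<Sigma>)\<^sup>-\<^sup>1]\<close>.\<close>

lemma under_hom_exists:
  assumes reg: "(D, F) \<in> reg_objs C (d ` I)"
    and sieves: "\<And>i. i \<in> I \<Longrightarrow> gen_sieve D (arr_map F ` N i) \<subseteq> gen_sieve D {arr_map F (d i)}"
  shows "\<exists>K. K \<in> under_hom C (Dil, \<Theta>) (D, F)"
proof -
  have F: "is_functor C D F" and faithful: "faithful_functor D (localization_functor D (arr_map F ` d ` I))"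
    using reg by (auto simp: reg_objs_def)
  interpret D: localizing D "arr_map F ` d ` I"
    using reg functor_arr[OF F d_arr]
    by (intro localizing.intro localizing_axioms.intro) (auto simp: reg_objs_def)
  define G where "G = comp_functor C D.L F"
  have G: "is_functor C D.Loc G"
    unfolding G_def by (rule is_functor_comp[OF category_axioms F D.is_functor_L])
  have G_arr: "arr_map G a = arr_map D.L (arr_map F a)" if "a \<in> Arr C" for a
    using that by (simp add: G_def comp_functor_arr)
  have "\<exists>g. inverse_arrows D.Loc (arr_map G s) g" if "s \<in> d ` I" for s
  proof -
    have "arr_map G s = arr_map D.L (arr_map F s)" using G_arr that d_arr by auto
    then show ?thesis using D.L_inverts[of "arr_map F s"] that by auto
  qed
  with D.category_Loc G obtain H where H: "is_functor Loc D.Loc H" "comp_functor C H L = G"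
    by (rule localization_lift)
  have HL: "arr_map H (arr_map L a) = arr_map D.L (arr_map F a)" if "a \<in> Arr C" for a
    using comp_functor_arr[OF that, of H L] H(2) G_arr[OF that] by simp
  have H_ob: "ob_map H X = ob_map F X" if "X \<in> Obj C" for X
    using comp_functor_ob[OF that, of H L] comp_functor_ob[OF that, of D.L F] H(2) that
    by (simp add: L_ob G_def D.L_ob functor_ob[OF F])
  \<comment> \<open>Having a preimage in \<open>D\<close> is checked along
    \<open>Dil_induct\<close>: preimages of composable factors can themselves be composed.\<close>
  have ex: "\<exists>y\<in>Arr D. arr_map D.L y = arr_map H \<phi>" if "\<phi> \<in> Arr Dil" for \<phi>
    using that
  proof (induction rule: Dil_induct)
    case (base a)
    then show ?case using HL functor_arr[OF F] by metis
  next
    case (step \<phi> i n)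
    note di = d_arr[OF step(2)] and n = N_arr[OF step(2,3)]
    note q = quot_Loc[OF step(2,3)] Dom_quot[OF step(2,3)] Cod_quot[OF step(2,3)]
    have Ld: "arr_map L (d i) \<in> Arr Loc" "Dom Loc (arr_map L (d i)) = Dom C (d i)"
      using di by (simp_all add: functor_simps[OF is_functor_L] L_ob Dom_in)
    \<comment> \<open>Composed with an identity, \<open>F(n)\<close> lies in the sieve it generates;
      the sieve condition then divides it by \<open>F(d i)\<close>.\<close>
    have "arr_map F n \<in> gen_sieve D (arr_map F ` N i)"
      using step(3) n D.Comp_Ide_right[of "arr_map F n"] D.Ide_in D.Cod_Ide D.Dom_in functor_arr[OF F n]
      unfolding gen_sieve_def by (intro CollectI exI[of _ "arr_map F n"] exI[of _ "Ide D (Dom D (arr_map F n))"]) simp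
    with sieves[OF step(2)] obtain x where x: "x \<in> Arr D" "Cod D x = Dom D (arr_map F (d i))"
      and Fn: "arr_map F n = Comp D (arr_map F (d i)) x"
      unfolding gen_sieve_def by blast
    \<comment> \<open>Composing either side with the invertible image of \<open>F(d i)\<close> gives
      the image of \<open>F(n)\<close> in \<open>D.Loc\<close>.\<close>
    have "arr_map D.L x = arr_map H (quot i n)"
    proof (rule inverse_arrows_cancel[OF D.category_Loc D.L_inverts])
      show "arr_map F (d i) \<in> arr_map F ` d ` I" using step(2) by blast
      have "Comp D.Loc (arr_map D.L (arr_map F (d i))) (arr_map D.L x) = arr_map D.L (arr_map F n)"
        using functor_Comp[OF D.is_functor_L x(1) functor_arr[OF F di] x(2)] Fn by simp
      also have "\<dots> = Comp D.Loc (arr_map D.L (arr_map F (d i))) (arr_map H (quot i n))"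
        using functor_Comp[OF H(1) q(1) Ld(1)] q Ld L_d_quot[OF step(2,3)] HL[OF di] HL[OF n] by simp
      finally show "Comp D.Loc (arr_map D.L (arr_map F (d i))) (arr_map D.L x) =
        Comp D.Loc (arr_map D.L (arr_map F (d i))) (arr_map H (quot i n))" .
    qed (use x q di in \<open>auto simp: functor_simps[OF D.is_functor_L] functor_simps[OF H(1)]
        functor_simps[OF F] H_ob D.L_ob Dom_in\<close>)
    moreover obtain y where y: "y \<in> Arr D" "arr_map D.L y = arr_map H \<phi>"
      using step(5) by blast
    moreover have "Cod D x = Dom D y"
      using x(2) functor_Dom[OF D.is_functor_L y(1)] functor_Dom[OF H(1) Dil_Loc[OF step(1)]]
        y step(4) di
      by (simp add: D.L_ob D.Dom_in H_ob Dom_in functor_Dom[OF F])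
    ultimately have "arr_map D.L (Comp D y x) = arr_map H (Comp Loc \<phi> (quot i n))"
      using functor_Comp[OF D.is_functor_L x(1) y(1)]
        functor_Comp[OF H(1) q(1) Dil_Loc[OF step(1)]] q step(4) by simp
    with D.Comp_in[OF x(1) y(1) \<open>Cod D x = Dom D y\<close>] show ?case by blast
  qed
  \<comment> \<open>A preimage is chosen; \<open>k_eq\<close> shows that it is the only one, so
    equations for \<open>k\<close> follow by exhibiting another preimage.\<close>
  define k where "k \<phi> = (SOME y. y \<in> Arr D \<and> arr_map D.L y = arr_map H \<phi>)" for \<phi>
  have k: "k \<phi> \<in> Arr D \<and> arr_map D.L (k \<phi>) = arr_map H \<phi>" if "\<phi> \<in> Arr Dil" for \<phi>
    unfolding k_def by (rule someI_ex) (use ex[OF that] in blast)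
  \<comment> \<open>\<open>D.L\<close> fixes objects and \<open>H\<close> acts on them as
    \<open>F\<close>, so the ends of a preimage are forced. Two preimages are therefore parallel, as
    \<open>faithful_functor\<close> demands.\<close>
  have ends: "Dom D y = ob_map F (Dom Loc \<phi>) \<and> Cod D y = ob_map F (Cod Loc \<phi>)"
    if "\<phi> \<in> Arr Dil" "y \<in> Arr D" "arr_map D.L y = arr_map H \<phi>" for \<phi> y
    using functor_Dom[OF D.is_functor_L that(2)] functor_Dom[OF H(1) Dil_Loc[OF that(1)]]
      functor_Cod[OF D.is_functor_L that(2)] functor_Cod[OF H(1) Dil_Loc[OF that(1)]] that(2,3)
      Loc.Dom_in[OF Dil_Loc[OF that(1)]] Loc.Cod_in[OF Dil_Loc[OF that(1)]]
    by (simp add: D.L_ob H_ob D.Dom_in D.Cod_in)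
  have k_eq: "k \<phi> = y" if "\<phi> \<in> Arr Dil" "y \<in> Arr D" "arr_map D.L y = arr_map H \<phi>" for \<phi> y
    using faithful k[OF that(1)] ends[OF that] ends[OF that(1), of "k \<phi>"] that
    unfolding faithful_functor_def by metis
  define K where "K = ((\<lambda>X\<in>Obj C. ob_map F X), (\<lambda>\<phi>\<in>Arr Dil. k \<phi>))"
  have K_ob: "ob_map K X = ob_map F X" if "X \<in> Obj C" for X
    using that by (simp add: K_def)
  have K_arr: "arr_map K \<phi> = k \<phi>" if "\<phi> \<in> Arr Dil" for \<phi>
    using that by (simp add: K_def)
  interpret Dil: category Dil by (rule category_Dil)
  have K: "is_functor Dil D K"
    unfolding is_functor_def
  proof (intro conjI ballI impI)
    show "ob_map K \<in> Obj Dil \<rightarrow>\<^sub>E Obj D" by (auto simp: K_def functor_ob[OF F])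
    show "arr_map K \<in> Arr Dil \<rightarrow>\<^sub>E Arr D" using k by (auto simp: K_def)
  next
    fix X assume "X \<in> Obj Dil"
    then have X: "X \<in> Obj C" by simp
    then have "k (Ide Loc X) = Ide D (ob_map F X)"
      using functor_Ide[OF H(1), of X] functor_Ide[OF D.is_functor_L functor_ob[OF F X]]
      by (intro k_eq Ide_in_Dil D.Ide_in functor_ob[OF F])
        (simp_all add: H_ob D.L_ob functor_ob[OF F])
    then show "arr_map K (Ide Dil X) = Ide D (ob_map K X)"
      using X by (simp add: K_arr K_ob Ide_in_Dil)
  next
    fix f assume f: "f \<in> Arr Dil"
    have kf: "Dom D (k f) = ob_map F (Dom Loc f)" "Cod D (k f) = ob_map F (Cod Loc f)"
      using ends[OF f] k[OF f] by auto
    show "Dom D (arr_map K f) = ob_map K (Dom Dil f)" "Cod D (arr_map K f) = ob_map K (Cod Dil f)"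
      using kf Dil.Dom_in[OF f] Dil.Cod_in[OF f] by (simp_all add: K_arr[OF f] K_ob)
    fix g assume g: "g \<in> Arr Dil" and c: "Cod Dil f = Dom Dil g"
    have kg: "Dom D (k g) = ob_map F (Dom Loc g)"
      using ends[OF g] k[OF g] by auto
    have c': "Cod D (k f) = Dom D (k g)" using kf kg c by simp
    \<comment> \<open>Since \<open>D.L\<close> and \<open>H\<close> respect composition, the
      right-hand side is a preimage and \<open>k_eq\<close> applies.\<close>
    have "k (Comp Loc g f) = Comp D (k g) (k f)"
      using k[OF f] k[OF g] c c' functor_Comp[OF D.is_functor_L _ _ c'] Dil_Loc[OF f] Dil_Loc[OF g]
      by (intro k_eq Dil_Comp f g D.Comp_in) (simp_all add: functor_Comp[OF H(1)])
    then show "arr_map K (Comp Dil g f) = Comp D (arr_map K g) (arr_map K f)"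
      using Dil_Comp[OF f g] c by (simp add: K_arr f g)
  qed
  moreover have "comp_functor C K \<Theta> = F"
  proof (rule functor_eqI[OF is_functor_comp[OF category_axioms is_functor_\<Theta> K] F])
    fix X assume "X \<in> Obj C"
    then show "ob_map (comp_functor C K \<Theta>) X = ob_map F X"
      by (simp add: comp_functor_ob \<Theta>_eq_L L_ob K_ob)
  next
    fix a assume a: "a \<in> Arr C"
    then have "k (arr_map L a) = arr_map F a"
      by (intro k_eq L_in_Dil functor_arr[OF F]) (simp_all add: HL)
    then show "arr_map (comp_functor C K \<Theta>) a = arr_map F a"
      using a by (simp add: comp_functor_arr \<Theta>_eq_L K_arr L_in_Dil)
  qed
  ultimately show ?thesis unfolding under_hom_def by (intro exI[of _ K]) simp
qed

end

section \<open>Functoriality of the sieve condition and representability\<close>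

lemma gen_sieve_functor_subset:
  assumes "category E" and G: "is_functor D E G" and "A \<subseteq> Arr D" "b \<in> Arr D" "category D"
    and sub: "gen_sieve D A \<subseteq> gen_sieve D {b}"
  shows "gen_sieve E (arr_map G ` A) \<subseteq> gen_sieve E {arr_map G b}"
proof
  interpret D: category D by fact
  interpret E: category E by fact
  fix x assume "x \<in> gen_sieve E (arr_map G ` A)"
  then obtain a m where a: "a \<in> A" "a \<in> Arr D" and m: "m \<in> Arr E" "Cod E m = Dom E (arr_map G a)"
    and x: "x = Comp E (arr_map G a) m"
    using assms(3) by (auto simp: gen_sieve_def)
  \<comment> \<open>Testing the inclusion on \<open>a\<close> itself gives a factorization through
    \<open>b\<close>, which \<open>G\<close> transports to \<open>E\<close>.\<close>
  have "a \<in> gen_sieve D A"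
    using a D.Comp_Ide_right[of a] D.Ide_in D.Cod_Ide D.Dom_in
    unfolding gen_sieve_def by (intro CollectI exI[of _ a] exI[of _ "Ide D (Dom D a)"]) simp
  then obtain y where y: "y \<in> Arr D" "Cod D y = Dom D b" "a = Comp D b y"
    using sub by (auto simp: gen_sieve_def)
  have Gy: "arr_map G y \<in> Arr E" "Cod E (arr_map G y) = Dom E (arr_map G b)" "Cod E m = Dom E (arr_map G y)"
    using m(2) functor_Dom[OF G a(2)] functor_Dom[OF G y(1)] D.Dom_Comp[OF y(1) assms(4) y(2)] y assms(4)
    by (simp_all add: functor_arr[OF G] functor_Cod[OF G] functor_Dom[OF G])
  have "x = Comp E (arr_map G b) (Comp E (arr_map G y) m)"
    using x y E.Comp_assoc[OF m(1) Gy(1) functor_arr[OF G assms(4)] Gy(3,2)] assms(4)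
    by (simp add: functor_Comp[OF G])
  then show "x \<in> gen_sieve E {arr_map G b}"
    using E.Comp_in[OF m(1) Gy(1,3)] E.Cod_Comp[OF m(1) Gy(1,3)] Gy(2)
    unfolding gen_sieve_def by auto
qed

theorem proposition3p12:
  fixes C :: "('o, 'm) cat"
    and I :: "'i set" and N :: "'i \<Rightarrow> 'm set" and d :: "'i \<Rightarrow> 'm"
  assumes "category C"
    and "center C I N d"
  shows "reg_set_functor C (d ` I)
           (dil_ob I N d :: ('o, 'm, 'p, 'q) under \<Rightarrow> unit set)
           (dil_arr I N d) \<and>
         represents C (d ` I) (dilatation C I N d, dilatation_functor C I d)
           (dil_ob I N d :: ('o, 'm, 'p, 'q) under \<Rightarrow> unit set)
           (dil_arr I N d)"
proof -
  interpret dilating C I N d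
    using assms by (intro dilating.intro dilating_axioms.intro)
  let ?h = "dil_ob I N d :: ('o, 'm, 'p, 'q) under \<Rightarrow> unit set"
  \<comment> \<open>\<open>dil_arr\<close> sends every point to \<open>()\<close>, so it maps into
    \<open>?h B\<close> only if \<open>?h B\<close> is inhabited whenever \<open>?h A\<close>
    is.\<close>
  have mono: "?h A \<subseteq> ?h B"
    if A: "A \<in> reg_objs C (d ` I)" and B: "B \<in> reg_objs C (d ` I)" and G: "G \<in> under_hom C A B" for A B G
  proof -
    obtain D F E F' where [simp]: "A = (D, F)" "B = (E, F')" by (cases A, cases B)
    have F: "category D" "category E" "is_functor C D F" "is_functor D E G" "F' = comp_functor C G F"
      using A B G by (auto simp: reg_objs_def under_hom_def)
    have "gen_sieve E (arr_map F' ` N i) \<subseteq> gen_sieve E {arr_map F' (d i)}"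
      if i: "i \<in> I" "gen_sieve D (arr_map F ` N i) \<subseteq> gen_sieve D {arr_map F (d i)}" for i
    proof -
      have "gen_sieve E (arr_map G ` arr_map F ` N i) \<subseteq> gen_sieve E {arr_map G (arr_map F (d i))}"
        using F i functor_arr[OF F(3)] d_arr N_arr
        by (intro gen_sieve_functor_subset[OF F(2,4)]) auto
      moreover have "arr_map G ` arr_map F ` N i = arr_map F' ` N i"
        unfolding image_image F(5)
        by (rule image_cong) (simp_all add: comp_functor_arr N_arr[OF i(1)])
      ultimately show ?thesis
        using i by (simp add: F(5) comp_functor_arr d_arr)
    qed
    then show ?thesis by (auto simp: dil_ob_def)
  qed
  have "reg_set_functor C (d ` I) ?h (dil_arr I N d)"
    unfolding reg_set_functor_def
  proof (intro conjI ballI)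
    fix A B :: "('o, 'm, 'p, 'q) under" and G
    assume "A \<in> reg_objs C (d ` I)" "B \<in> reg_objs C (d ` I)" "G \<in> under_hom C A B"
    from mono[OF this] show "dil_arr I N d A B G \<in> ?h A \<rightarrow>\<^sub>E ?h B"
      by (auto simp: dil_arr_def)
  qed (auto simp: dil_arr_def compose_def fun_eq_iff)
  moreover have "represents C (d ` I) (Dil, \<Theta>) ?h (dil_arr I N d)"
    unfolding represents_def
  \<comment> \<open>The constant map is the only candidate. Naturality becomes an equation in
    \<open>unit\<close>, and bijectivity says that the hom set is a singleton or empty according to
    the sieve condition.\<close>
  proof (intro conjI exI[of _ "\<lambda>_ _. ()"] ballI)
    fix A assume A: "A \<in> (reg_objs C (d ` I) :: ('o, 'm, 'p, 'q) under set)"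
    obtain D F where [simp]: "A = (D, F)" by (cases A)
    have F: "category D" "is_functor C D F" using A by (auto simp: reg_objs_def)
    show "bij_betw (\<lambda>_. ()) (under_hom C (Dil, \<Theta>) A) (?h A)"
    proof (cases "\<forall>i\<in>I. gen_sieve D (arr_map F ` N i) \<subseteq> gen_sieve D {arr_map F (d i)}")
      case True
      then obtain K where "K \<in> under_hom C (Dil, \<Theta>) (D, F)"
        using under_hom_exists A by fastforce
      then have "under_hom C (Dil, \<Theta>) (D, F) = {K}"
        using under_hom_unique[OF A[unfolded \<open>A = (D, F)\<close>]] by blast
      then show ?thesis using True by (simp add: dil_ob_def bij_betw_def)
    next
      case False
      then have "under_hom C (Dil, \<Theta>) (D, F) = {}"
        using under_hom_imp_sieves[OF F] by blast
      then show ?thesis using False by (auto simp: dil_ob_def bij_betw_def)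
    qed
  qed (simp_all add: \<Theta>_regular)
  ultimately show ?thesis by blast
qed

end
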